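(* Consider a private coded distributed computing (private CDC) model with $K$ nodes and $Q$ output functions, $Q\ge K$. For positive integers $D$ and $t\in[D-1]$ let $P_{D,t}$ be the $\binom Dt\times D$ array with rows indexed by the $t$-subsets $T$ of $[D]$ and columns by $d\in[D]$, whose entry is $*$ if $d\in T$ and $y_{t+1}(T\cup\{d\})$ if $d\notin T$, where $y_{t+1}(T')$ denotes the position of the $(t+1)$-subset $T'$ of $[D]$ in the lexicographic order; $P_{D,t}$ is a $\left(D,\binom{D}{t},\binom{D-1}{t-1},\binom{D}{t+1}\right)$ PDA in which each integer appears $t+1$ times. For $r_1\in[K-1]$ and $r_2\in[Q-1]$, let $\mathbf P_{r_1,r_2}$ be the array obtained from $P_{K,r_1}$ by replacing each integer entry $s$ by the block $P_{Q,r_2}+(s-1)\binom{Q}{r_2+1}$ (with $*+(s-1)\binom{Q}{r_2+1}=*$) and each $*$ by the $\binom{Q}{r_2}\times Q$ block of $*$'s; this gives the set $\mathcal P=\{\mathbf P_{r_1,r_2}: r_1\in[K-1],\,r_2\in[Q-1]\}$ of extended PDAs with parameters $$\left(KQ,\ \binom{K}{r_1}\binom{Q}{r_2},\ \binom{K-1}{r_1-1}\binom{Q}{r_2+1}\left(\frac{Q}{r_2}-\frac{K-r_1}{r_1}\right),\ \binom{K}{r_1+1}\binom{Q}{r_2+1}\right).$$ Then the set $\mathcal P$ corresponds to the private CDC model and achieves computation and communication loads given by the points $$(r,L_p)=\left(r_1+\frac{(K-r_1)r_2}{Q},\ \frac{1}{r_1}\left(1-\frac{r_1}{K}\right)\left(\frac{Q-r_2}{r_2+1}\right)\right),\qquad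 \forall\, r_1\in[K-1],\ r_2\in[Q-1].$$
   Context: Notation: $[n]=\{1,\dots,n\}$; for an array $A$ and integer $b$, $A+b$ is obtained by adding $b$ to every integer entry (stars are unchanged). PDA. For positive integers $K,F,Z,S$, an $F\times K$ array $P=[p_{f,k}]$ composed of the symbol $*$ and the integers in $[S]$ is a $(K,F,Z,S)$ placement delivery array (PDA) if: (A1) the symbol $*$ appears $Z$ times in each column; (A2) each integer of $[S]$ occurs at least once in the array; (A3) two distinct entries $p_{f_1,k_1}$ and $p_{f_2,k_2}$ are equal to the same integer only if $f_1\ne f_2$, $k_1\neq k_2$, and $p_{f_1,k_2}=p_{f_2,k_1}=*$. Private CDC model with $K$ nodes and $Q$ output functions. There are $N$ files $\mathcal W=\{W_1,\dots,W_N\}$ of $w$ bits each, and output functions $\phi_q(\mathcal W)=h_q(v_{q,1},\dots,v_{q,N})$, $q\in[Q]$, where $v_{q,n}=g_q(W_n)\in\mathbb F_{2^\alpha}$ are the intermediate values (IVs, $\alpha$ bits each), with map functions $g_q:\mathbb F_{2^w}\to\mathbb F_{2^\alpha}$ and reduce functions $h_q:\mathbb F_{2^\alpha}^N\to\mathbb F_{2^b}$. Node $k\in[K]$ is assigned to compute $\phi_{d_k}$, $d_k\in[Q]$. A scheme has three phases. (1) Map: node $k$ generates local randomness $a_k$, independent of $\mathcal W$ and independent across nodes and known only to node $k$, stores a subset of files $\mathcal M_k\subseteq\mathcal W$ with $H(\mathcal M_k\mid a_k,\mathcal W)=0$, and computes the IVs $v_{q,n}$, $q\in[Q]$, of its stored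 files. (2) Shuffle: given $a_k$, $\mathcal M_k$ and $\phi_{d_k}$, node $k$ generates a query $\mathbf y_k$ and broadcasts it to all other nodes. Privacy is required: for every $k\in[K]$, $I(\{d_j\}_{j\in[K]};\{\mathbf y_j\}_{j\in[K]}\mid d_k,\mathcal M_k)=0$. Then node $k$ broadcasts a coded sequence $\mathbf X_k\in\{0,1\}^{\ell_k}$ with $H(\mathbf X_k\mid\mathcal M_k,a_k,\{\mathbf y_j\}_{j\in[K]})=0$. (3) Reduce: each node $k$ decodes what it needs to compute its function, i.e. $H(\phi_{d_k}\mid\mathcal M_k,a_k,d_k,\{\mathbf y_j\}_{j\in[K]},\{\mathbf X_j\}_{j\in[K]})=0$. Loads. The computation load is $r=\frac{1}{N}\sum_{k=1}^K|\mathcal M_k|$. The communication load is the total number of bits of the coded sequences transmitted in the Shuffle phase normalized by the number of bits in all IVs, $L=\frac{1}{QN\alpha}\sum_{k=1}^K\ell_k$. PDA corresponding to the model. A PDA $\mathbf P=[p_{f,j}]$ with $F$ rows and $KQ$ columns corresponds to a scheme for the model in which the $N$ files are grouped into $F$ disjoint batches $B_1,\dots,B_F$ of $N/F$ files each (one per row), and node $k$ stores the files of the batches $B_f$ with $p_{f,\beta_k}=*$, where $\beta_k=(k-1)Q+a_k$ with $a_k$ uniform on $[Q]$.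
   Formalization: Z is corrected to C(K-1,r1-1)C(Q-1,r2-1)(Q/r2+(K-r1)/r1); the printed one fails at K=Q=2, r1=r2=1 (3, not 1). Loads are claimed when C(K,r1)C(Q,r2) divides N, r1 divides the IV bits per batch (N/F)α, and L_p·QNα is an integer; for K<Q the load L_p is reached by padding. *)

theory Defs
  imports "HOL-Probability.Probability"
begin

section \<open>Placement delivery arrays\<close>

datatype entry = Star | Num nat

text \<open>An array is a function of the row and the column, both numbered from 1; values outside the
  stated dimensions are irrelevant.\<close>

type_synonym arr = "nat \<Rightarrow> nat \<Rightarrow> entry"

definition is_pda :: "nat \<Rightarrow> nat \<Rightarrow> nat \<Rightarrow> nat \<Rightarrow> arr \<Rightarrow> bool" where
  "is_pda K F Z S P \<longleftrightarrow>
     0 < K \<and> 0 < F \<and> 0 < Z \<and> 0 < S \<and>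
     (\<forall>f\<in>{1..F}. \<forall>k\<in>{1..K}. P f k \<in> insert Star (Num ` {1..S})) \<and>
     (\<forall>k\<in>{1..K}. card {f\<in>{1..F}. P f k = Star} = Z) \<and>
     (\<forall>s\<in>{1..S}. \<exists>f\<in>{1..F}. \<exists>k\<in>{1..K}. P f k = Num s) \<and>
     (\<forall>f1\<in>{1..F}. \<forall>f2\<in>{1..F}. \<forall>k1\<in>{1..K}. \<forall>k2\<in>{1..K}. \<forall>s.
        (f1, k1) \<noteq> (f2, k2) \<and> P f1 k1 = Num s \<and> P f2 k2 = Num s \<longrightarrow>
        f1 \<noteq> f2 \<and> k1 \<noteq> k2 \<and> P f1 k2 = Star \<and> P f2 k1 = Star)"

definition occurrences :: "nat \<Rightarrow> nat \<Rightarrow> arr \<Rightarrow> nat \<Rightarrow> nat" where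
  "occurrences K F P s = card {(f, k). f \<in> {1..F} \<and> k \<in> {1..K} \<and> P f k = Num s}"

definition subsets_of_size :: "nat \<Rightarrow> nat \<Rightarrow> nat set set" where
  "subsets_of_size D t = {T. T \<subseteq> {1..D} \<and> card T = t}"

text \<open>The position, starting from 1, of a \<open>t\<close>-subset of \<open>{1..D}\<close> in the lexicographic order; sets
  are compared through their increasing enumerations.\<close>

definition lex_pos :: "nat \<Rightarrow> nat \<Rightarrow> nat set \<Rightarrow> nat" where
  "lex_pos D t T =
     card {T' \<in> subsets_of_size D t.
             (sorted_list_of_set T', sorted_list_of_set T) \<in> lex less_than} + 1"

text \<open>Row \<open>f\<close> of this array is the row indexed by the \<open>t\<close>-subset in lexicographic position \<open>f\<close>.\<close>

definition subset_pda :: "nat \<Rightarrow> nat \<Rightarrow> arr" where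
  "subset_pda D t f d =
     (let T = inv_into (subsets_of_size D t) (lex_pos D t) f
      in if d \<in> T then Star else Num (lex_pos D (t + 1) (insert d T)))"

fun shift :: "nat \<Rightarrow> entry \<Rightarrow> entry" where
  "shift c Star = Star"
| "shift c (Num s) = Num (s + c)"

text \<open>Block substitution: the block row and the row inside the block of the overall row \<open>f\<close> are
  \<open>(f - 1) div m + 1\<close> and \<open>(f - 1) mod m + 1\<close> with \<open>m = Q choose r2\<close>, and similarly for the
  columns, where the blocks have width \<open>Q\<close>.\<close>

definition extended_pda :: "nat \<Rightarrow> nat \<Rightarrow> nat \<Rightarrow> nat \<Rightarrow> arr" where
  "extended_pda K Q r1 r2 f c =
     (case subset_pda K r1 ((f - 1) div (Q choose r2) + 1) ((c - 1) div Q + 1) of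
        Star \<Rightarrow> Star
      | Num s \<Rightarrow> shift ((s - 1) * (Q choose (r2 + 1)))
                  (subset_pda Q r2 ((f - 1) mod (Q choose r2) + 1) ((c - 1) mod Q + 1)))"

section \<open>Private coded distributed computing\<close>

text \<open>The random vector $(x_1,\dots,x_m)$.\<close>

definition tuple :: "nat \<Rightarrow> (nat \<Rightarrow> 'a \<Rightarrow> 'v) \<Rightarrow> 'a \<Rightarrow> 'v list" where
  "tuple m x \<omega> = map (\<lambda>i. x i \<omega>) [1..<Suc m]"

text \<open>Elements of the field with $2^m$ elements are represented by bit strings of length \<open>m\<close>; its
  multiplication plays no role in the model. \<open>W n\<close> is the \<open>n\<close>-th file, and \<open>d k\<close> is the index of
  the function assigned to node \<open>k\<close>. No assumption is made on the joint distribution of the files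
  and the assignment. Entropies are in bits.\<close>

locale private_cdc = information_space M 2 for M :: "'a measure" +
  fixes K Q N w \<alpha> b :: nat
    and W :: "nat \<Rightarrow> 'a \<Rightarrow> bool list"
    and d :: "nat \<Rightarrow> 'a \<Rightarrow> nat"
    and g :: "nat \<Rightarrow> bool list \<Rightarrow> bool list"
    and h :: "nat \<Rightarrow> bool list list \<Rightarrow> bool list"
  assumes pos: "0 < K" "0 < Q" "0 < N" "0 < w" "0 < \<alpha>" "0 < b"
    and files: "\<And>n. n \<in> {1..N} \<Longrightarrow> simple_function M (W n)"
      "\<And>n \<omega>. n \<in> {1..N} \<Longrightarrow> \<omega> \<in> space M \<Longrightarrow> length (W n \<omega>) = w"
    and assignment: "\<And>k. k \<in> {1..K} \<Longrightarrow> simple_function M (d k)"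
      "\<And>k \<omega>. k \<in> {1..K} \<Longrightarrow> \<omega> \<in> space M \<Longrightarrow> d k \<omega> \<in> {1..Q}"
    and map_functions: "\<And>q x. q \<in> {1..Q} \<Longrightarrow> length x = w \<Longrightarrow> length (g q x) = \<alpha>"
    and reduce_functions: "\<And>q vs. q \<in> {1..Q} \<Longrightarrow> length vs = N \<Longrightarrow>
      (\<forall>v\<in>set vs. length v = \<alpha>) \<Longrightarrow> length (h q vs) = b"
begin

notation conditional_entropy_Pow (\<open>\<H>'(_ | _')\<close>)
notation conditional_mutual_information_Pow (\<open>\<I>'(_ ; _ | _')\<close>)

definition iv :: "nat \<Rightarrow> nat \<Rightarrow> 'a \<Rightarrow> bool list" where
  "iv q n \<omega> = g q (W n \<omega>)"

definition \<phi> :: "nat \<Rightarrow> 'a \<Rightarrow> bool list" where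
  "\<phi> q \<omega> = h q (tuple N (iv q) \<omega>)"

text \<open>The variables \<open>a 1\<close>, ..., \<open>a K\<close> and the pair of all files and all assignments (index 0) are
  mutually independent. They have different types, hence the formulation by the generated
  \<open>\<sigma>\<close>-algebras.\<close>

definition local_randomness :: "(nat \<Rightarrow> 'a \<Rightarrow> 'r) \<Rightarrow> bool" where
  "local_randomness a \<longleftrightarrow>
     (\<forall>k\<in>{1..K}. simple_function M (a k)) \<and>
     indep_sets
       (\<lambda>k. if k = 0 then range (\<lambda>A. (\<lambda>\<omega>. (tuple N W \<omega>, tuple K d \<omega>)) -` A \<inter> space M)
            else range (\<lambda>A. a k -` A \<inter> space M))
       {0..K}"

text \<open>\<open>m k\<close> is the storage of node \<open>k\<close>: a random partial function from file indices to file
  contents, whose domain is the index set of the stored files. \<open>y k\<close> is the query and \<open>X k\<close> the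
  coded sequence, of length \<open>len k\<close>, broadcast by node \<open>k\<close>.\<close>

definition cdc_scheme ::
  "(nat \<Rightarrow> 'a \<Rightarrow> 'r) \<Rightarrow> (nat \<Rightarrow> 'a \<Rightarrow> (nat \<rightharpoonup> bool list)) \<Rightarrow> (nat \<Rightarrow> 'a \<Rightarrow> 'y) \<Rightarrow>
   (nat \<Rightarrow> 'a \<Rightarrow> bool list) \<Rightarrow> (nat \<Rightarrow> nat) \<Rightarrow> bool" where
  "cdc_scheme a m y X len \<longleftrightarrow>
     local_randomness a \<and>
     (\<forall>k\<in>{1..K}.
        simple_function M (m k) \<and> simple_function M (y k) \<and> simple_function M (X k) \<and>
        (\<forall>\<omega>\<in>space M. \<exists>I\<subseteq>{1..N}. m k \<omega> = (\<lambda>n. Some (W n \<omega>)) |` I) \<and>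
        \<H>(m k | (\<lambda>\<omega>. (a k \<omega>, tuple N W \<omega>))) = 0 \<and>
        \<H>(y k | (\<lambda>\<omega>. (a k \<omega>, m k \<omega>, d k \<omega>))) = 0 \<and>
        \<I>(tuple K d ; tuple K y | (\<lambda>\<omega>. (d k \<omega>, m k \<omega>))) = 0 \<and>
        (\<forall>\<omega>\<in>space M. length (X k \<omega>) = len k) \<and>
        \<H>(X k | (\<lambda>\<omega>. (m k \<omega>, a k \<omega>, tuple K y \<omega>))) = 0 \<and>
        \<H>((\<lambda>\<omega>. \<phi> (d k \<omega>) \<omega>) | (\<lambda>\<omega>. (m k \<omega>, a k \<omega>, d k \<omega>, tuple K y \<omega>, tuple K X \<omega>))) = 0)"

definition computation_load :: "(nat \<Rightarrow> 'a \<Rightarrow> (nat \<rightharpoonup> bool list)) \<Rightarrow> 'a \<Rightarrow> real" where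
  "computation_load m \<omega> = (\<Sum>k=1..K. real (card (dom (m k \<omega>)))) / real N"

definition communication_load :: "(nat \<Rightarrow> nat) \<Rightarrow> real" where
  "communication_load len = (\<Sum>k=1..K. real (len k)) / (real Q * real N * real \<alpha>)"

definition uniform_on_functions :: "(nat \<Rightarrow> 'a \<Rightarrow> nat) \<Rightarrow> bool" where
  "uniform_on_functions a \<longleftrightarrow>
     (\<forall>k\<in>{1..K}. (\<forall>\<omega>\<in>space M. a k \<omega> \<in> {1..Q}) \<and>
        distr M (count_space {1..Q}) (a k) = uniform_count_measure {1..Q})"

definition pda_corresponds ::
  "nat \<Rightarrow> arr \<Rightarrow> (nat \<Rightarrow> 'a \<Rightarrow> nat) \<Rightarrow> (nat \<Rightarrow> 'a \<Rightarrow> (nat \<rightharpoonup> bool list)) \<Rightarrow> bool" where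
  "pda_corresponds F P a m \<longleftrightarrow>
     uniform_on_functions a \<and> F dvd N \<and>
     (\<exists>B :: nat \<Rightarrow> nat set.
        disjoint_family_on B {1..F} \<and> (\<Union>f\<in>{1..F}. B f) = {1..N} \<and>
        (\<forall>f\<in>{1..F}. card (B f) = N div F) \<and>
        (\<forall>k\<in>{1..K}. \<forall>\<omega>\<in>space M.
           dom (m k \<omega>) = (\<Union>f\<in>{f\<in>{1..F}. P f ((k - 1) * Q + a k \<omega>) = Star}. B f)))"

end

end

theory Submission
  imports Defs
begin

text \<open>Rows of the extended array are pairs \<open>(T1, T2)\<close> of an \<open>r1\<close>-subset of the nodes and an
  \<open>r2\<close>-subset of the functions; its integers are pairs \<open>(U1, U2)\<close> of subsets with one more
  element, occurring at \<open>(U1 - {k}, U2 - {j})\<close> in the column \<open>(k, j)\<close>. Node \<open>k\<close> selects one of its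
  columns \<open>(k, 1)\<close>, ..., \<open>(k, Q)\<close> at random and broadcasts a cyclic assignment of the functions to
  these columns which gives its own function to the selected one; this offset is uniform and
  independent of the assignment. For each integer \<open>(U1, U2)\<close>, each batch of intermediate values
  demanded at an occurrence in the block column \<open>k\<close> is cut into \<open>r1\<close> pieces, one for each node of
  \<open>U1 - {k}\<close>, and each \<open>k' \<in> U1\<close> broadcasts the sum of its pieces over all
  \<open>(k, j) \<in> (U1 - {k'}) \<times> U2\<close>. It stores all of them as \<open>k' \<in> U1 - {k}\<close>, and a receiver \<open>k\<close> with
  selected column \<open>a \<in> U2\<close> stores all of them except the one at \<open>(k, a)\<close>, which it wants.

  All conditions of the form \<open>H(X | Y) = 0\<close> hold since \<open>X\<close> is a function of \<open>Y\<close>; this is shown by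
  comparing two outcomes with the same value of \<open>Y\<close>, so no decoder has to be written down.\<close>

section \<open>The arrays\<close>

text \<open>Ranks strictly increase along \<open>R\<close>, so they are injective, and they stay
  inside a set with as many elements as \<open>A\<close>. The lemma serves both the lexicographic
  order of subsets and the rank of a node inside \<open>T1\<close>.\<close>

lemma bij_betw_rank:
  assumes fin: "finite A"
    and irrefl: "\<And>x. x \<in> A \<Longrightarrow> \<not> R x x"
    and trans: "\<And>x y z. x \<in> A \<Longrightarrow> y \<in> A \<Longrightarrow> z \<in> A \<Longrightarrow> R x y \<Longrightarrow> R y z \<Longrightarrow> R x z"
    and total: "\<And>x y. x \<in> A \<Longrightarrow> y \<in> A \<Longrightarrow> x \<noteq> y \<Longrightarrow> R x y \<or> R y x"
  shows "bij_betw (\<lambda>x. card {y \<in> A. R y x} + 1) A {1..card A}"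
proof -
  let ?r = "\<lambda>x. card {y \<in> A. R y x} + 1"
  have less: "?r x < ?r y" if "x \<in> A" "y \<in> A" "R x y" for x y
  proof -
    have "{z \<in> A. R z x} \<subset> {z \<in> A. R z y}"
      using that irrefl trans by blast
    then show ?thesis
      using fin by (simp add: psubset_card_mono)
  qed
  have inj: "inj_on ?r A"
  proof (rule inj_onI, rule ccontr)
    fix x y assume "x \<in> A" "y \<in> A" "?r x = ?r y" "x \<noteq> y"
    then show False using less[of x y] less[of y x] total[of x y] by auto
  qed
  have "?r x \<in> {1..card A}" if "x \<in> A" for x
  proof -
    have "{y \<in> A. R y x} \<subset> A"
      using that irrefl by blast
    from psubset_card_mono[OF fin this] show ?thesis by simp
  qed
  then have "?r ` A \<subseteq> {1..card A}" by blast
  moreover have "card (?r ` A) = card {1..card A}"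
    using inj by (simp add: card_image)
  ultimately show ?thesis
    using inj by (simp add: bij_betw_def card_subset_eq)
qed

lemma finite_subsets_of_size [simp]: "finite (subsets_of_size D t)"
  by (simp add: subsets_of_size_def)

lemma card_subsets_of_size [simp]: "card (subsets_of_size D t) = D choose t"
  using n_subsets[of "{1..D}" t] by (simp add: subsets_of_size_def)

lemma subsets_of_sizeD:
  assumes "T \<in> subsets_of_size D t"
  shows "T \<subseteq> {1..D}" "card T = t" "finite T"
  using assms by (auto simp: subsets_of_size_def intro: finite_subset)

lemma insert_subsets_of_size:
  assumes "T \<in> subsets_of_size D t" "c \<in> {1..D}" "c \<notin> T"
  shows "insert c T \<in> subsets_of_size D (Suc t)"
  using assms subsets_of_sizeD(3)[OF assms(1)] by (auto simp: subsets_of_size_def)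

lemma remove_subsets_of_size:
  assumes "U \<in> subsets_of_size D (Suc t)" "c \<in> U"
  shows "U - {c} \<in> subsets_of_size D t"
  using assms subsets_of_sizeD(3)[OF assms(1)] by (auto simp: subsets_of_size_def)

text \<open>\<open>lex\<close> relates only lists of equal length; this suffices for totality
  because increasing enumerations of \<open>t\<close>-subsets all have length \<open>t\<close> and
  determine their sets.\<close>

lemma lex_pos_bij: "bij_betw (lex_pos D t) (subsets_of_size D t) {1..D choose t}"
proof -
  let ?R = "\<lambda>T' T. (sorted_list_of_set T', sorted_list_of_set T) \<in> lex less_than"
  have "bij_betw (\<lambda>x. card {y \<in> subsets_of_size D t. ?R y x} + 1) (subsets_of_size D t)
          {1..card (subsets_of_size D t)}"
  proof (rule bij_betw_rank)
    show "\<not> ?R x x" for x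
      by (rule lexl_not_refl) (simp add: irrefl_def)
    show "?R x z" if "?R x y" "?R y z" for x y z
      using lex_transI[OF trans_less_than] that by (meson transD)
    show "?R x y \<or> ?R y x"
      if "x \<in> subsets_of_size D t" "y \<in> subsets_of_size D t" "x \<noteq> y" for x y
    proof -
      have "sorted_list_of_set x \<noteq> sorted_list_of_set y"
        using that by (metis set_sorted_list_of_set subsets_of_sizeD(3))
      moreover have "length (sorted_list_of_set x) = length (sorted_list_of_set y)"
        using that by (simp add: subsets_of_sizeD)
      ultimately show ?thesis
        using total_lexord[OF total_less_than] by (auto simp: lexord_lex total_on_def)
    qed
  qed simp
  moreover have "lex_pos D t = (\<lambda>x. card {y \<in> subsets_of_size D t. ?R y x} + 1)"
    by (simp add: lex_pos_def fun_eq_iff)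
  ultimately show ?thesis by simp
qed

definition row :: "nat \<Rightarrow> nat \<Rightarrow> nat \<Rightarrow> nat set" where
  "row D t = inv_into (subsets_of_size D t) (lex_pos D t)"

lemma row_bij: "bij_betw (row D t) {1..D choose t} (subsets_of_size D t)"
  unfolding row_def by (rule bij_betw_inv_into[OF lex_pos_bij])

lemma row_in: "f \<in> {1..D choose t} \<Longrightarrow> row D t f \<in> subsets_of_size D t"
  by (rule bij_betw_apply[OF row_bij])

lemma row_lex_pos: "T \<in> subsets_of_size D t \<Longrightarrow> row D t (lex_pos D t T) = T"
  unfolding row_def by (rule bij_betw_inv_into_left[OF lex_pos_bij])

lemma lex_pos_in: "T \<in> subsets_of_size D t \<Longrightarrow> lex_pos D t T \<in> {1..D choose t}"
  by (rule bij_betw_apply[OF lex_pos_bij])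

lemma lex_pos_row: "f \<in> {1..D choose t} \<Longrightarrow> lex_pos D t (row D t f) = f"
  unfolding row_def by (rule bij_betw_inv_into_right[OF lex_pos_bij])

lemma lex_pos_eq_iff:
  "T \<in> subsets_of_size D t \<Longrightarrow> T' \<in> subsets_of_size D t \<Longrightarrow>
   lex_pos D t T = lex_pos D t T' \<longleftrightarrow> T = T'"
  by (rule inj_on_eq_iff[OF bij_betw_imp_inj_on[OF lex_pos_bij]])

section \<open>The PDA of \<open>t\<close>-subsets\<close>

lemma subset_pda_row:
  "subset_pda D t f c =
     (if c \<in> row D t f then Star else Num (lex_pos D (Suc t) (insert c (row D t f))))"
  by (simp add: subset_pda_def row_def Let_def)

lemma subset_pda_eq_Num:
  assumes "f \<in> {1..D choose t}" "c \<in> {1..D}" "U \<in> subsets_of_size D (Suc t)"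
  shows "subset_pda D t f c = Num (lex_pos D (Suc t) U) \<longleftrightarrow> c \<in> U \<and> row D t f = U - {c}"
proof -
  have "insert c (row D t f) = U \<longleftrightarrow> c \<in> U \<and> row D t f = U - {c}" if "c \<notin> row D t f"
    using that by blast
  then show ?thesis
    using lex_pos_eq_iff[OF insert_subsets_of_size[OF row_in[OF assms(1)] assms(2)] assms(3)]
    by (auto simp: subset_pda_row simp del: insert_Diff_single)
qed

text \<open>Deleting \<open>c\<close> leaves an arbitrary \<open>(t - 1)\<close>-subset of the other
  \<open>D - 1\<close> elements. Besides the stars of a column, this later counts the sets
  \<open>U1\<close> in which a node takes part.\<close>

lemma card_subsets_containing:
  assumes "c \<in> {1..D}" "0 < t"
  shows "card {T \<in> subsets_of_size D t. c \<in> T} = (D - 1) choose (t - 1)"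
proof -
  let ?B = "{T. T \<subseteq> {1..D} - {c} \<and> card T = t - 1}"
  have "bij_betw (insert c) ?B {T \<in> subsets_of_size D t. c \<in> T}"
  proof (rule bij_betw_byWitness[where f' = "\<lambda>T. T - {c}"])
    show "insert c ` ?B \<subseteq> {T \<in> subsets_of_size D t. c \<in> T}"
    proof clarsimp
      fix T assume T: "T \<subseteq> {Suc 0..D} - {c}" "card T = t - Suc 0"
      moreover have "finite T" using T(1) by (rule finite_subset) simp
      ultimately show "insert c T \<in> subsets_of_size D t"
        using assms by (auto simp: subsets_of_size_def card_insert_if)
    qed
    show "(\<lambda>T. T - {c}) ` {T \<in> subsets_of_size D t. c \<in> T} \<subseteq> ?B"
      by (auto simp: subsets_of_size_def)
  qed auto
  then have "card ?B = card {T \<in> subsets_of_size D t. c \<in> T}"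
    by (rule bij_betw_same_card)
  moreover have "card ?B = (D - 1) choose (t - 1)"
    using n_subsets[of "{1..D} - {c}" "t - 1"] assms by simp
  ultimately show ?thesis by simp
qed

lemma card_rows_containing:
  assumes "c \<in> {1..D}" "0 < t"
  shows "card {f \<in> {1..D choose t}. c \<in> row D t f} = (D - 1) choose (t - 1)"
proof -
  have "bij_betw (row D t) {f \<in> {1..D choose t}. c \<in> row D t f} {T \<in> subsets_of_size D t. c \<in> T}"
    by (rule bij_betw_subset[OF row_bij]) (use bij_betw_imp_surj_on[OF row_bij, of D t] in blast)+
  then have "card {f \<in> {1..D choose t}. c \<in> row D t f} = card {T \<in> subsets_of_size D t. c \<in> T}"
    by (rule bij_betw_same_card)
  then show ?thesis
    by (simp only: card_subsets_containing[OF assms])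
qed

text \<open>The occurrences of the integer belonging to \<open>U\<close> are parametrised by the
  elements \<open>c\<close> of \<open>U\<close>: the column is \<open>c\<close> and the row is
  labelled \<open>U - {c}\<close>.\<close>

lemma occurrences_subset_pda:
  assumes "s \<in> {1..D choose (Suc t)}"
  shows "occurrences D (D choose t) (subset_pda D t) s = Suc t"
proof -
  define U where "U = row D (Suc t) s"
  have U: "U \<in> subsets_of_size D (Suc t)" "lex_pos D (Suc t) U = s"
    using assms by (auto simp: U_def row_in lex_pos_row)
  have "{(f, c). f \<in> {1..D choose t} \<and> c \<in> {1..D} \<and> subset_pda D t f c = Num s} =
        (\<lambda>c. (lex_pos D t (U - {c}), c)) ` U" (is "?L = ?R")
  proof (intro equalityI subsetI)
    fix x assume "x \<in> ?L"
    then show "x \<in> ?R"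
      using U subset_pda_eq_Num[OF _ _ U(1)] by (auto simp: image_iff) (metis atLeastAtMost_iff One_nat_def lex_pos_row)
  next
    fix x assume "x \<in> ?R"
    then obtain c where c: "c \<in> U" "x = (lex_pos D t (U - {c}), c)" by blast
    have UC: "U - {c} \<in> subsets_of_size D t"
      using U c remove_subsets_of_size by blast
    have "c \<in> {1..D}" using c U subsets_of_sizeD(1) by blast
    then show "x \<in> ?L"
      using c lex_pos_in[OF UC] subset_pda_eq_Num[OF lex_pos_in[OF UC] _ U(1)] U(2) row_lex_pos[OF UC]
      by auto
  qed
  moreover have "card ?R = Suc t"
    using subsets_of_sizeD(2)[OF U(1)] by (subst card_image) (auto simp: inj_on_def)
  ultimately show ?thesis by (simp add: occurrences_def)
qed

lemma is_pda_subset_pda: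
  assumes t: "t \<in> {1..D - 1}"
  shows "is_pda D (D choose t) ((D - 1) choose (t - 1)) (D choose (Suc t)) (subset_pda D t)"
  unfolding is_pda_def
proof (intro conjI ballI allI impI)
  show "0 < D" "0 < D choose t" "0 < (D - 1) choose (t - 1)" "0 < D choose (Suc t)"
    using t by auto
next
  fix f c assume f: "f \<in> {1..D choose t}" and c: "c \<in> {1..D}"
  then show "subset_pda D t f c \<in> insert Star (Num ` {1..D choose (Suc t)})"
    using lex_pos_in[OF insert_subsets_of_size[OF row_in[OF f] c]] by (auto simp: subset_pda_row)
next
  fix c assume c: "c \<in> {1..D}"
  have "{f \<in> {1..D choose t}. subset_pda D t f c = Star} = {f \<in> {1..D choose t}. c \<in> row D t f}"
    by (auto simp: subset_pda_row)
  then show "card {f \<in> {1..D choose t}. subset_pda D t f c = Star} = (D - 1) choose (t - 1)"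
    using card_rows_containing[OF c] t by simp
next
  fix s assume s: "s \<in> {1..D choose (Suc t)}"
  \<comment> \<open>(A2) follows from the number of occurrences, \<open>Suc t\<close>, being
    positive.\<close>
  show "\<exists>f\<in>{1..D choose t}. \<exists>k\<in>{1..D}. subset_pda D t f k = Num s"
  proof (rule ccontr)
    assume "\<not> ?thesis"
    then have *: "{(f, k). f \<in> {1..D choose t} \<and> k \<in> {1..D} \<and> subset_pda D t f k = Num s} = {}"
      by blast
    show False
      using occurrences_subset_pda[OF s] unfolding occurrences_def * by simp
  qed
next
  fix f1 f2 c1 c2 s
  assume f: "f1 \<in> {1..D choose t}" "f2 \<in> {1..D choose t}"
    and c: "c1 \<in> {1..D}" "c2 \<in> {1..D}"
    and *: "(f1, c1) \<noteq> (f2, c2) \<and> subset_pda D t f1 c1 = Num s \<and> subset_pda D t f2 c2 = Num s"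
  have n: "c1 \<notin> row D t f1" "c2 \<notin> row D t f2"
    using * by (auto simp: subset_pda_row split: if_splits)
  then have "lex_pos D (Suc t) (insert c1 (row D t f1)) = lex_pos D (Suc t) (insert c2 (row D t f2))"
    using * by (auto simp: subset_pda_row)
  \<comment> \<open>Equal integers mean equal enlarged sets. Once the columns are known to differ,
    each of them must lie in the row label of the other entry, which gives the stars of
    (A3).\<close>
  then have eq: "insert c1 (row D t f1) = insert c2 (row D t f2)"
    by (rule lex_pos_eq_iff[OF insert_subsets_of_size[OF row_in[OF f(1)] c(1) n(1)]
        insert_subsets_of_size[OF row_in[OF f(2)] c(2) n(2)], THEN iffD1])
  have "c1 \<noteq> c2"
  proof
    assume [simp]: "c1 = c2"
    then have "row D t f1 = row D t f2" using eq n by (metis insert_ident)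
    then have "f1 = f2" using f by (metis lex_pos_row)
    then show False using * by simp
  qed
  moreover have "c1 \<in> insert c2 (row D t f2)" "c2 \<in> insert c1 (row D t f1)"
    unfolding eq[symmetric] by simp (simp add: eq)
  ultimately have "c1 \<in> row D t f2" "c2 \<in> row D t f1" by auto
  then show "f1 \<noteq> f2" "c1 \<noteq> c2" "subset_pda D t f1 c2 = Star" "subset_pda D t f2 c1 = Star"
    using n \<open>c1 \<noteq> c2\<close> by (auto simp: subset_pda_row)
qed

section \<open>Block substitution of one PDA into another\<close>

text \<open>The block construction for two arbitrary arrays, so that the PDA property can be derived
  from (A1) to (A3) of the factors alone, without subsets.\<close>

definition substitute :: "nat \<Rightarrow> nat \<Rightarrow> nat \<Rightarrow> arr \<Rightarrow> arr \<Rightarrow> arr" where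
  "substitute F K S P1 P2 f c =
     (case P1 ((f - 1) div F + 1) ((c - 1) div K + 1) of
        Star \<Rightarrow> Star
      | Num s \<Rightarrow> shift ((s - 1) * S) (P2 ((f - 1) mod F + 1) ((c - 1) mod K + 1)))"

lemma extended_pda_substitute:
  "extended_pda K Q r1 r2 =
     substitute (Q choose r2) Q (Q choose (r2 + 1)) (subset_pda K r1) (subset_pda Q r2)"
  by (intro ext) (simp only: extended_pda_def substitute_def)

lemma block_index:
  fixes i j m :: nat
  assumes "0 < i" "0 < j" "j \<le> m"
  shows "((i - 1) * m + j - 1) div m + 1 = i" "((i - 1) * m + j - 1) mod m + 1 = j"
proof -
  obtain i' j' where "i = Suc i'" "j = Suc j'"
    using assms by (metis gr0_implies_Suc)
  then show "((i - 1) * m + j - 1) div m + 1 = i" "((i - 1) * m + j - 1) mod m + 1 = j"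
    using assms by auto
qed

text \<open>Two-digit numbering with both digits starting at 1. It is used for the rows, columns and
  integers of a substituted array, for files in batches, bits in batches and pieces of a
  batch.\<close>

lemma block_index_bij:
  "bij_betw (\<lambda>(i, j). (i - 1) * m + j) ({1..n} \<times> {1..m}) {1..n * m :: nat}"
proof (rule bij_betw_byWitness[where f' = "\<lambda>x. ((x - 1) div m + 1, (x - 1) mod m + 1)"])
  show "\<forall>x\<in>{1..n} \<times> {1..m}. (((case x of (i, j) \<Rightarrow> (i - 1) * m + j) - 1) div m + 1,
      ((case x of (i, j) \<Rightarrow> (i - 1) * m + j) - 1) mod m + 1) = x"
    using block_index[of _ _ m] by fastforce
  show "\<forall>x\<in>{1..n * m}. (case ((x - 1) div m + 1, (x - 1) mod m + 1) of (i, j) \<Rightarrow> (i - 1) * m + j) = x"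
    by auto
  show "(\<lambda>(i, j). (i - 1) * m + j) ` ({1..n} \<times> {1..m}) \<subseteq> {1..n * m}"
  proof (rule image_subsetI, clarify)
    fix i j assume ij: "i \<in> {1..n}" "j \<in> {1..m}"
    then have "(i - 1) * m + j \<le> (i - 1) * m + m" by simp
    also have "\<dots> = i * m" using ij by (cases i) auto
    also have "\<dots> \<le> n * m" using ij by simp
    finally show "(i - 1) * m + j \<in> {1..n * m}"
      using ij by simp
  qed
  show "(\<lambda>x. ((x - 1) div m + 1, (x - 1) mod m + 1)) ` {1..n * m} \<subseteq> {1..n} \<times> {1..m}"
  proof (rule image_subsetI)
    fix x assume x: "x \<in> {1..n * m}"
    then have "0 < m" by (cases m) auto
    moreover have "x - 1 < n * m" using x by auto
    ultimately show "((x - 1) div m + 1, (x - 1) mod m + 1) \<in> {1..n} \<times> {1..m}"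
      by (simp add: Suc_le_eq less_mult_imp_div_less)
  qed
qed

lemma block_index_in:
  fixes i j n m :: nat
  assumes "i \<in> {1..n}" "j \<in> {1..m}"
  shows "(i - 1) * m + j \<in> {1..n * m}"
  using bij_betw_apply[OF block_index_bij, of "(i, j)" n m] assms by simp

lemma block_indexE:
  fixes x :: nat
  assumes "x \<in> {1..n * m}"
  obtains i j where "i \<in> {1..n}" "j \<in> {1..m}" "x = (i - 1) * m + j"
proof -
  have "x \<in> (\<lambda>(i, j). (i - 1) * m + j) ` ({1..n} \<times> {1..m})"
    using assms by (simp only: bij_betw_imp_surj_on[OF block_index_bij])
  then show thesis using that by (elim imageE SigmaE) (simp only: prod.case)
qed

lemma substitute_block:
  assumes "0 < i" "j \<in> {1..F}" "0 < k" "l \<in> {1..K}"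
  shows "substitute F K S P1 P2 ((i - 1) * F + j) ((k - 1) * K + l) =
     (case P1 i k of Star \<Rightarrow> Star | Num s \<Rightarrow> shift ((s - 1) * S) (P2 j l))"
proof -
  have j: "0 < j" "j \<le> F" and l: "0 < l" "l \<le> K" using assms by auto
  show ?thesis
    unfolding substitute_def block_index[OF assms(1) j] block_index[OF assms(3) l] ..
qed

lemma shift_eq_simps [simp]:
  "shift c e = Star \<longleftrightarrow> e = Star"
  "shift c e = Num s \<longleftrightarrow> (\<exists>s'. e = Num s' \<and> s = s' + c)"
  by (cases e; auto)+

lemma substitute_block_eq_Star:
  assumes "0 < i" "j \<in> {1..F}" "0 < k" "l \<in> {1..K}"
  shows "substitute F K S P1 P2 ((i - 1) * F + j) ((k - 1) * K + l) = Star \<longleftrightarrow>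
     P1 i k = Star \<or> P2 j l = Star"
  by (subst substitute_block[OF assms]) (auto split: entry.split)

lemma substitute_block_eq_Num:
  assumes "0 < i" "j \<in> {1..F}" "0 < k" "l \<in> {1..K}"
  shows "substitute F K S P1 P2 ((i - 1) * F + j) ((k - 1) * K + l) = Num s \<longleftrightarrow>
     (\<exists>s1 s2. P1 i k = Num s1 \<and> P2 j l = Num s2 \<and> s = (s1 - 1) * S + s2)"
  by (subst substitute_block[OF assms]) (auto split: entry.split)

lemma card_block_index:
  "card {x \<in> {1..n * m :: nat}. R x} = card {(i, j) \<in> {1..n} \<times> {1..m}. R ((i - 1) * m + j)}"
proof -
  let ?f = "\<lambda>(i, j). (i - 1) * m + j"
  have "?f ` {(i, j) \<in> {1..n} \<times> {1..m}. R ((i - 1) * m + j)} = {x \<in> ?f ` ({1..n} \<times> {1..m}). R x}"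
    by (auto simp del: atLeastAtMost_iff)
  also have "\<dots> = {x \<in> {1..n * m}. R x}"
    by (simp only: bij_betw_imp_surj_on[OF block_index_bij])
  finally have "bij_betw ?f {(i, j) \<in> {1..n} \<times> {1..m}. R ((i - 1) * m + j)} {x \<in> {1..n * m}. R x}"
    by (intro bij_betw_subset[OF block_index_bij]) auto
  then show ?thesis by (simp add: bij_betw_same_card)
qed

text \<open>(A3) is restated as a dichotomy that allows coinciding positions: two different
  positions of a substituted array may still agree in the outer or in the inner coordinates.\<close>

lemma is_pdaD:
  assumes "is_pda K F Z S P"
  shows "0 < K" "0 < F" "0 < Z" "0 < S"
    and "f \<in> {1..F} \<Longrightarrow> k \<in> {1..K} \<Longrightarrow> P f k \<in> insert Star (Num ` {1..S})"
    and "k \<in> {1..K} \<Longrightarrow> card {f \<in> {1..F}. P f k = Star} = Z"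
    and "s \<in> {1..S} \<Longrightarrow> \<exists>f\<in>{1..F}. \<exists>k\<in>{1..K}. P f k = Num s"
    and "f1 \<in> {1..F} \<Longrightarrow> f2 \<in> {1..F} \<Longrightarrow> k1 \<in> {1..K} \<Longrightarrow> k2 \<in> {1..K} \<Longrightarrow>
      P f1 k1 = Num s \<Longrightarrow> P f2 k2 = Num s \<Longrightarrow>
      f1 = f2 \<and> k1 = k2 \<or> f1 \<noteq> f2 \<and> k1 \<noteq> k2 \<and> P f1 k2 = Star \<and> P f2 k1 = Star"
proof -
  from assms show "0 < K" "0 < F" "0 < Z" "0 < S"
    unfolding is_pda_def by - (elim conjE, assumption)+
  from assms have 1: "\<forall>f\<in>{1..F}. \<forall>k\<in>{1..K}. P f k \<in> insert Star (Num ` {1..S})"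
    and 2: "\<forall>k\<in>{1..K}. card {f\<in>{1..F}. P f k = Star} = Z"
    and 3: "\<forall>s\<in>{1..S}. \<exists>f\<in>{1..F}. \<exists>k\<in>{1..K}. P f k = Num s"
    and 4: "\<forall>f1\<in>{1..F}. \<forall>f2\<in>{1..F}. \<forall>k1\<in>{1..K}. \<forall>k2\<in>{1..K}. \<forall>s.
        (f1, k1) \<noteq> (f2, k2) \<and> P f1 k1 = Num s \<and> P f2 k2 = Num s \<longrightarrow>
        f1 \<noteq> f2 \<and> k1 \<noteq> k2 \<and> P f1 k2 = Star \<and> P f2 k1 = Star"
    unfolding is_pda_def by - (elim conjE, assumption)+
  show "f \<in> {1..F} \<Longrightarrow> k \<in> {1..K} \<Longrightarrow> P f k \<in> insert Star (Num ` {1..S})"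
    using 1 by blast
  show "k \<in> {1..K} \<Longrightarrow> card {f \<in> {1..F}. P f k = Star} = Z"
    using 2 by blast
  show "s \<in> {1..S} \<Longrightarrow> \<exists>f\<in>{1..F}. \<exists>k\<in>{1..K}. P f k = Num s"
    using 3 by blast
  assume "f1 \<in> {1..F}" "f2 \<in> {1..F}" "k1 \<in> {1..K}" "k2 \<in> {1..K}"
    and eq: "P f1 k1 = Num s" "P f2 k2 = Num s"
  then have "(f1, k1) \<noteq> (f2, k2) \<longrightarrow> f1 \<noteq> f2 \<and> k1 \<noteq> k2 \<and> P f1 k2 = Star \<and> P f2 k1 = Star"
    using 4[THEN bspec, THEN bspec, THEN bspec, THEN bspec, THEN spec, of f1 f2 k1 k2 s] by blast
  then show "f1 = f2 \<and> k1 = k2 \<or> f1 \<noteq> f2 \<and> k1 \<noteq> k2 \<and> P f1 k2 = Star \<and> P f2 k1 = Star"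
    by blast
qed

text \<open>A column meets \<open>Z1\<close> blocks consisting of stars, with \<open>F2\<close> rows
  each, and \<open>F1 - Z1\<close> blocks with \<open>Z2\<close> stars each. For (A3), equal
  integers agree in both digits, and a star in either factor makes the substituted entry a
  star.\<close>

lemma is_pda_substitute:
  assumes P1: "is_pda K1 F1 Z1 S1 P1" and P2: "is_pda K2 F2 Z2 S2 P2"
  shows "is_pda (K1 * K2) (F1 * F2) (Z1 * F2 + (F1 - Z1) * Z2) (S1 * S2)
           (substitute F2 K2 S2 P1 P2)"
proof -
  let ?P = "substitute F2 K2 S2 P1 P2"
  have star: "?P ((i - 1) * F2 + j) ((k - 1) * K2 + l) = Star \<longleftrightarrow> P1 i k = Star \<or> P2 j l = Star"
    if "i \<in> {1..F1}" "j \<in> {1..F2}" "k \<in> {1..K1}" "l \<in> {1..K2}" for i j k l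
    by (rule substitute_block_eq_Star) (use that in auto)
  have num: "?P ((i - 1) * F2 + j) ((k - 1) * K2 + l) = Num s \<longleftrightarrow>
      (\<exists>s1\<in>{1..S1}. \<exists>s2\<in>{1..S2}. P1 i k = Num s1 \<and> P2 j l = Num s2 \<and> s = (s1 - 1) * S2 + s2)"
    if ij: "i \<in> {1..F1}" "j \<in> {1..F2}" "k \<in> {1..K1}" "l \<in> {1..K2}" for i j k l s
  proof -
    have "s1 \<in> {1..S1}" "s2 \<in> {1..S2}" if "P1 i k = Num s1" "P2 j l = Num s2" for s1 s2
      using is_pdaD(5)[OF P1 ij(1,3)] is_pdaD(5)[OF P2 ij(2,4)] that by auto
    moreover have "?P ((i - 1) * F2 + j) ((k - 1) * K2 + l) = Num s \<longleftrightarrow>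
        (\<exists>s1 s2. P1 i k = Num s1 \<and> P2 j l = Num s2 \<and> s = (s1 - 1) * S2 + s2)"
      by (rule substitute_block_eq_Num) (use ij in auto)
    ultimately show ?thesis by blast
  qed
  have Z: "card {f \<in> {1..F1 * F2}. ?P f c = Star} = Z1 * F2 + (F1 - Z1) * Z2"
    if c: "c \<in> {1..K1 * K2}" for c
  proof -
    obtain k l where kl: "k \<in> {1..K1}" "l \<in> {1..K2}" "c = (k - 1) * K2 + l"
      using c by (rule block_indexE)
    let ?A = "{i \<in> {1..F1}. P1 i k = Star}" and ?B = "{j \<in> {1..F2}. P2 j l = Star}"
    have "{(i, j) \<in> {1..F1} \<times> {1..F2}. ?P ((i - 1) * F2 + j) c = Star} =
        ?A \<times> {1..F2} \<union> ({1..F1} - ?A) \<times> ?B"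
      using star kl by auto
    moreover have "card (?A \<times> {1..F2} \<union> ({1..F1} - ?A) \<times> ?B) = Z1 * F2 + (F1 - Z1) * Z2"
    proof (subst card_Un_disjoint)
      have "card ?A = Z1" "card ?B = Z2" using is_pdaD(6)[OF P1 kl(1)] is_pdaD(6)[OF P2 kl(2)] by auto
      then show "card (?A \<times> {1..F2}) + card (({1..F1} - ?A) \<times> ?B) = Z1 * F2 + (F1 - Z1) * Z2"
        by (simp only: card_cartesian_product card_atLeastAtMost, subst card_Diff_subset) auto
    qed auto
    ultimately show ?thesis
      using card_block_index[of F1 F2 "\<lambda>f. ?P f c = Star"] by simp
  qed
  show ?thesis
    unfolding is_pda_def
  proof (intro conjI ballI allI impI)
    show "0 < K1 * K2" "0 < F1 * F2" "0 < Z1 * F2 + (F1 - Z1) * Z2" "0 < S1 * S2"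
      using is_pdaD(1-4)[OF P1] is_pdaD(1-4)[OF P2] by simp_all
  next
    fix f c assume "f \<in> {1..F1 * F2}" "c \<in> {1..K1 * K2}"
    then obtain i j k l where ijkl: "i \<in> {1..F1}" "j \<in> {1..F2}" "k \<in> {1..K1}" "l \<in> {1..K2}"
      and fc: "f = (i - 1) * F2 + j" "c = (k - 1) * K2 + l"
      by (meson block_indexE)
    show "?P f c \<in> insert Star (Num ` {1..S1 * S2})"
    proof (cases "?P f c")
      case (Num s)
      then have "?P ((i - 1) * F2 + j) ((k - 1) * K2 + l) = Num s"
        by (simp only: fc)
      from num[OF ijkl, THEN iffD1, OF this]
      obtain s1 s2 where "s1 \<in> {1..S1}" "s2 \<in> {1..S2}" "s = (s1 - 1) * S2 + s2" by blast
      then have "s \<in> {1..S1 * S2}"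
        by (simp only: block_index_in)
      then show ?thesis using Num by auto
    qed simp
  next
    fix c assume "c \<in> {1..K1 * K2}"
    then show "card {f \<in> {1..F1 * F2}. ?P f c = Star} = Z1 * F2 + (F1 - Z1) * Z2" by (rule Z)
  next
    fix s assume "s \<in> {1..S1 * S2}"
    then obtain s1 s2 where s: "s1 \<in> {1..S1}" "s2 \<in> {1..S2}" "s = (s1 - 1) * S2 + s2"
      by (rule block_indexE)
    obtain i k where ik: "i \<in> {1..F1}" "k \<in> {1..K1}" "P1 i k = Num s1"
      using is_pdaD(7)[OF P1 s(1)] by blast
    obtain j l where jl: "j \<in> {1..F2}" "l \<in> {1..K2}" "P2 j l = Num s2"
      using is_pdaD(7)[OF P2 s(2)] by blast
    note ijkl = ik(1) jl(1) ik(2) jl(2) ik(3) jl(3)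
    then have "?P ((i - 1) * F2 + j) ((k - 1) * K2 + l) = Num s"
      using s num[OF ijkl(1-4), THEN iffD2] by blast
    moreover have "(i - 1) * F2 + j \<in> {1..F1 * F2}" "(k - 1) * K2 + l \<in> {1..K1 * K2}"
      using ijkl by (simp_all only: block_index_in)
    ultimately show "\<exists>f\<in>{1..F1 * F2}. \<exists>c\<in>{1..K1 * K2}. ?P f c = Num s" by blast
  next
    fix f f' c c' s
    assume f: "f \<in> {1..F1 * F2}" and f': "f' \<in> {1..F1 * F2}"
      and c: "c \<in> {1..K1 * K2}" and c': "c' \<in> {1..K1 * K2}"
      and *: "(f, c) \<noteq> (f', c') \<and> ?P f c = Num s \<and> ?P f' c' = Num s"
    obtain i j where ij: "i \<in> {1..F1}" "j \<in> {1..F2}" "f = (i - 1) * F2 + j"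
      using f by (rule block_indexE)
    obtain i' j' where ij': "i' \<in> {1..F1}" "j' \<in> {1..F2}" "f' = (i' - 1) * F2 + j'"
      using f' by (rule block_indexE)
    obtain k l where kl: "k \<in> {1..K1}" "l \<in> {1..K2}" "c = (k - 1) * K2 + l"
      using c by (rule block_indexE)
    obtain k' l' where kl': "k' \<in> {1..K1}" "l' \<in> {1..K2}" "c' = (k' - 1) * K2 + l'"
      using c' by (rule block_indexE)
    have eq: "?P ((i - 1) * F2 + j) ((k - 1) * K2 + l) = Num s"
      "?P ((i' - 1) * F2 + j') ((k' - 1) * K2 + l') = Num s"
      using * by (simp_all only: ij(3) ij'(3) kl(3) kl'(3))
    obtain s1 s2 where s: "s1 \<in> {1..S1}" "s2 \<in> {1..S2}" "s = (s1 - 1) * S2 + s2"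
      and e: "P1 i k = Num s1" "P2 j l = Num s2"
      using num[OF ij(1,2) kl(1,2), THEN iffD1, OF eq(1)] by blast
    obtain t1 t2 where t: "t1 \<in> {1..S1}" "t2 \<in> {1..S2}" "s = (t1 - 1) * S2 + t2"
      and e': "P1 i' k' = Num t1" "P2 j' l' = Num t2"
      using num[OF ij'(1,2) kl'(1,2), THEN iffD1, OF eq(2)] by blast
    \<comment> \<open>The two digits of \<open>s\<close> are unique, as \<open>s2\<close> and
      \<open>t2\<close> lie in \<open>{1..S2}\<close>.\<close>
    have "s1 = t1" "s2 = t2"
      using s t block_index[of s1 s2 S2] block_index[of t1 t2 S2] by force+
    with e' have e': "P1 i' k' = Num s1" "P2 j' l' = Num s2" by auto
    have A: "(i, k) = (i', k') \<or> i \<noteq> i' \<and> k \<noteq> k' \<and> P1 i k' = Star \<and> P1 i' k = Star"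
      using is_pdaD(8)[OF P1 ij(1) ij'(1) kl(1) kl'(1) e(1) e'(1)] by blast
    have B: "(j, l) = (j', l') \<or> j \<noteq> j' \<and> l \<noteq> l' \<and> P2 j l' = Star \<and> P2 j' l = Star"
      using is_pdaD(8)[OF P2 ij(2) ij'(2) kl(2) kl'(2) e(2) e'(2)] by blast
    \<comment> \<open>The positions differ at one level at least; the dichotomy at that level
      supplies the stars and makes rows and columns differ.\<close>
    have ne: "\<not> ((i, k) = (i', k') \<and> (j, l) = (j', l'))"
      using * ij ij' kl kl' by auto
    have f_iff: "f = f' \<longleftrightarrow> i = i' \<and> j = j'"
      using ij ij' block_index[of i j F2] block_index[of i' j' F2] by auto
    have c_iff: "c = c' \<longleftrightarrow> k = k' \<and> l = l'"
      using kl kl' block_index[of k l K2] block_index[of k' l' K2] by auto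
    show "f \<noteq> f'" "c \<noteq> c'" using A B ne f_iff c_iff by auto
    show "?P f c' = Star" "?P f' c = Star"
      using A B ne star ij ij' kl kl' by auto
  qed
qed

section \<open>Parameters of the extended arrays\<close>

lemma binomial_absorb_real:
  assumes "0 < k" "k \<le> n"
  shows "real (n choose k) = real ((n - 1) choose (k - 1)) * (real n / real k)"
proof -
  obtain n' k' where "n = Suc n'" "k = Suc k'"
    using assms by (metis gr0_implies_Suc less_le_trans)
  then show ?thesis
    using Suc_times_binomial_eq[of n' k'] by (simp add: field_simps flip: of_nat_mult of_nat_Suc)
qed

text \<open>\<open>Z\<close> adds the stars of the full star blocks and those inside the integer
  blocks. Absorption extracts the common factor: the first part contributes \<open>Q / r2\<close>
  and the second \<open>K / r1 - 1\<close>. For \<open>K = Q = 2\<close> and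
  \<open>r1 = r2 = 1\<close> this means 3 stars among the 4 entries of a column.\<close>

lemma extended_pda_is_pda:
  assumes r1: "r1 \<in> {1..K - 1}" and r2: "r2 \<in> {1..Q - 1}"
  defines "Z \<equiv> ((K - 1) choose (r1 - 1)) * (Q choose r2) +
                ((K choose r1) - ((K - 1) choose (r1 - 1))) * ((Q - 1) choose (r2 - 1))"
  shows "is_pda (K * Q) ((K choose r1) * (Q choose r2)) Z
           ((K choose (r1 + 1)) * (Q choose (r2 + 1))) (extended_pda K Q r1 r2)"
    and "real Z = real ((K - 1) choose (r1 - 1)) * real ((Q - 1) choose (r2 - 1)) *
           (real Q / real r2 + (real K - real r1) / real r1)"
proof -
  show "is_pda (K * Q) ((K choose r1) * (Q choose r2)) Z
           ((K choose (r1 + 1)) * (Q choose (r2 + 1))) (extended_pda K Q r1 r2)"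
    unfolding Z_def extended_pda_substitute
    by (rule is_pda_substitute[OF is_pda_subset_pda[OF r1] is_pda_subset_pda[OF r2], unfolded Suc_eq_plus1])
  obtain K' r1' where K': "K = Suc K'" "r1 = Suc r1'"
    using r1 by (cases K; cases r1) auto
  then have le: "((K - 1) choose (r1 - 1)) \<le> (K choose r1)" by simp
  have Ka: "real (K choose r1) = real ((K - 1) choose (r1 - 1)) * (real K / real r1)"
    and Qa: "real (Q choose r2) = real ((Q - 1) choose (r2 - 1)) * (real Q / real r2)"
    using binomial_absorb_real[of r1 K] binomial_absorb_real[of r2 Q] r1 r2 by auto
  have "real K / real r1 - 1 = (real K - real r1) / real r1"
    using r1 by (simp add: field_simps)
  then have "real ((K choose r1) - ((K - 1) choose (r1 - 1))) =
      real ((K - 1) choose (r1 - 1)) * ((real K - real r1) / real r1)"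
    using le Ka by (simp add: of_nat_diff algebra_simps)
  then show "real Z = real ((K - 1) choose (r1 - 1)) * real ((Q - 1) choose (r2 - 1)) *
           (real Q / real r2 + (real K - real r1) / real r1)"
    unfolding Z_def by (simp only: of_nat_add of_nat_mult Qa) (simp add: algebra_simps)
qed

section \<open>Privacy\<close>

context information_space
begin

text \<open>\<open>X\<close> factors through \<open>Y\<close>: from a value of \<open>Y\<close>,
  pick some outcome with that value and evaluate \<open>X\<close> there.\<close>

lemma simple_function_determined:
  assumes Y: "simple_function M Y"
    and det: "\<And>\<omega> \<omega>'. \<omega> \<in> space M \<Longrightarrow> \<omega>' \<in> space M \<Longrightarrow> Y \<omega> = Y \<omega>' \<Longrightarrow> X \<omega> = X \<omega>'"
  shows "simple_function M X"
proof -
  have "X \<omega> = X (inv_into (space M) Y (Y \<omega>))" if "\<omega> \<in> space M" for \<omega>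
    using that by (intro det) (auto intro: inv_into_into simp: f_inv_into_f)
  moreover have "simple_function M (\<lambda>\<omega>. X (inv_into (space M) Y (Y \<omega>)))"
    using Y by (rule simple_function_compose1)
  ultimately show ?thesis
    by (subst simple_function_cong) auto
qed

text \<open>The joint event of the values of \<open>X\<close> and \<open>Y\<close> at an outcome is
  already the event for \<open>Y\<close>, so every summand has the form
  \<open>p * log 2 (p / p)\<close> up to the base and vanishes, also for
  \<open>p = 0\<close>.\<close>

lemma conditional_entropy_determined:
  assumes Y: "simple_function M Y"
    and det: "\<And>\<omega> \<omega>'. \<omega> \<in> space M \<Longrightarrow> \<omega>' \<in> space M \<Longrightarrow> Y \<omega> = Y \<omega>' \<Longrightarrow> X \<omega> = X \<omega>'"
  shows "conditional_entropy_Pow X Y = 0"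
proof -
  have X: "simple_function M X"
    using assms by (rule simple_function_determined)
  have "(\<lambda>x. (X x, Y x)) -` {(X \<omega>, Y \<omega>)} \<inter> space M = Y -` {Y \<omega>} \<inter> space M"
    if "\<omega> \<in> space M" for \<omega>
    using that by (auto intro: det)
  then show ?thesis
    by (subst conditional_entropy_eq[OF simple_distributedI[OF Y measure_nonneg refl]
          simple_distributedI[OF simple_function_Pair[OF X Y] measure_nonneg refl]])
      (auto intro!: sum.neutral simp: log_def)
qed

text \<open>\<open>c y z\<close> acts as the conditional probability of \<open>Y = y\<close> given
  \<open>Z = z\<close>, and the hypothesis says that knowing \<open>X\<close> does not change it.
  The product form avoids conditioning on null events; summing over \<open>x\<close> gives the same
  factor for the law of \<open>(Y, Z)\<close>.\<close>

lemma conditional_mutual_information_eq_0: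
  assumes X: "simple_function M X" and Y: "simple_function M Y" and Z: "simple_function M Z"
    and indep: "\<And>x y z. prob {\<omega> \<in> space M. X \<omega> = x \<and> Y \<omega> = y \<and> Z \<omega> = z} =
                  c y z * prob {\<omega> \<in> space M. X \<omega> = x \<and> Z \<omega> = z}"
  shows "conditional_mutual_information_Pow X Y Z = 0"
proof -
  note XYZ = simple_function_Pair[OF X simple_function_Pair[OF Y Z]]
    and XZ = simple_function_Pair[OF X Z] and YZ = simple_function_Pair[OF Y Z]
  have eq: "Z -` {z} \<inter> space M = {\<omega> \<in> space M. Z \<omega> = z}"
    "(\<lambda>\<omega>. (X \<omega>, Z \<omega>)) -` {(x, z)} \<inter> space M = {\<omega> \<in> space M. X \<omega> = x \<and> Z \<omega> = z}"
    "(\<lambda>\<omega>. (Y \<omega>, Z \<omega>)) -` {(y, z)} \<inter> space M = {\<omega> \<in> space M. Y \<omega> = y \<and> Z \<omega> = z}"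
    "(\<lambda>\<omega>. (X \<omega>, Y \<omega>, Z \<omega>)) -` {(x, y, z)} \<inter> space M =
       {\<omega> \<in> space M. X \<omega> = x \<and> Y \<omega> = y \<and> Z \<omega> = z}" for x y z
    by auto
  have ev: "{\<omega> \<in> space M. Z \<omega> = z} \<in> events" "{\<omega> \<in> space M. X \<omega> = x \<and> Z \<omega> = z} \<in> events"
    "{\<omega> \<in> space M. X \<omega> = x \<and> Y \<omega> = y \<and> Z \<omega> = z} \<in> events" for x y z
    using simple_functionD(2)[OF Z, of "{z}"] simple_functionD(2)[OF XZ, of "{(x, z)}"]
      simple_functionD(2)[OF XYZ, of "{(x, y, z)}"]
    unfolding eq by auto
  have fin: "finite (X ` space M)" using X by (rule simple_functionD)
  have Pz: "prob {\<omega> \<in> space M. Z \<omega> = z} = (\<Sum>x\<in>X ` space M. prob {\<omega> \<in> space M. X \<omega> = x \<and> Z \<omega> = z})" for z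
  proof -
    have "prob (\<Union>x\<in>X ` space M. {\<omega> \<in> space M. X \<omega> = x \<and> Z \<omega> = z}) =
        (\<Sum>x\<in>X ` space M. prob {\<omega> \<in> space M. X \<omega> = x \<and> Z \<omega> = z})"
      by (rule finite_measure_finite_Union) (use fin ev in \<open>auto simp: disjoint_family_on_def\<close>)
    moreover have "(\<Union>x\<in>X ` space M. {\<omega> \<in> space M. X \<omega> = x \<and> Z \<omega> = z}) = {\<omega> \<in> space M. Z \<omega> = z}"
      by auto
    ultimately show ?thesis by simp
  qed
  have Pyz: "prob {\<omega> \<in> space M. Y \<omega> = y \<and> Z \<omega> = z} = c y z * prob {\<omega> \<in> space M. Z \<omega> = z}" for y z
  proof -
    have "prob (\<Union>x\<in>X ` space M. {\<omega> \<in> space M. X \<omega> = x \<and> Y \<omega> = y \<and> Z \<omega> = z}) =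
        (\<Sum>x\<in>X ` space M. prob {\<omega> \<in> space M. X \<omega> = x \<and> Y \<omega> = y \<and> Z \<omega> = z})"
      by (rule finite_measure_finite_Union) (use fin ev in \<open>auto simp: disjoint_family_on_def\<close>)
    moreover have "(\<Union>x\<in>X ` space M. {\<omega> \<in> space M. X \<omega> = x \<and> Y \<omega> = y \<and> Z \<omega> = z}) =
        {\<omega> \<in> space M. Y \<omega> = y \<and> Z \<omega> = z}"
      by auto
    ultimately show ?thesis by (simp add: indep Pz sum_distrib_left)
  qed
  show ?thesis
  proof (subst conditional_mutual_information_eq[OF simple_distributedI[OF Z measure_nonneg refl]
        simple_distributedI[OF YZ measure_nonneg refl] simple_distributedI[OF XZ measure_nonneg refl]
        simple_distributedI[OF XYZ measure_nonneg refl]], intro sum.neutral ballI, clarify)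
    fix x y z \<omega> assume "\<omega> \<in> space M"
    let ?Pxz = "prob {\<omega>' \<in> space M. X \<omega>' = X \<omega> \<and> Z \<omega>' = Z \<omega>}"
      and ?Pz = "prob {\<omega>' \<in> space M. Z \<omega>' = Z \<omega>}" and ?c = "c (Y \<omega>) (Z \<omega>)"
    \<comment> \<open>Either the factor in front is 0, or \<open>?Pz\<close> is at least the
      positive \<open>?Pxz\<close> and the quotient under the logarithm is 1.\<close>
    have "?c * ?Pxz * log b (?c * ?Pxz / (?Pxz * (?c * ?Pz / ?Pz))) = 0"
    proof (cases "?c * ?Pxz = 0")
      case False
      then have "0 < ?Pxz" by (simp add: zero_less_measure_iff)
      moreover have "?Pxz \<le> ?Pz"
        using ev by (intro finite_measure_mono) auto
      ultimately show ?thesis using False by auto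
    qed auto
    then show "prob ((\<lambda>\<omega>. (X \<omega>, Y \<omega>, Z \<omega>)) -` {(X \<omega>, Y \<omega>, Z \<omega>)} \<inter> space M) *
        log b (prob ((\<lambda>\<omega>. (X \<omega>, Y \<omega>, Z \<omega>)) -` {(X \<omega>, Y \<omega>, Z \<omega>)} \<inter> space M) /
          (prob ((\<lambda>\<omega>. (X \<omega>, Z \<omega>)) -` {(X \<omega>, Z \<omega>)} \<inter> space M) *
           (prob ((\<lambda>\<omega>. (Y \<omega>, Z \<omega>)) -` {(Y \<omega>, Z \<omega>)} \<inter> space M) /
            prob (Z -` {Z \<omega>} \<inter> space M)))) = 0"
      unfolding eq indep Pyz .
  qed
qed

end

section \<open>Random vectors and cyclic offsets\<close>

lemma tuple_eq_iff: "tuple m x \<omega> = tuple m x \<omega>' \<longleftrightarrow> (\<forall>i\<in>{1..m}. x i \<omega> = x i \<omega>')"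
  by (auto simp: tuple_def)

lemma length_tuple [simp]: "length (tuple m x \<omega>) = m"
  by (simp add: tuple_def)

lemma nth_tuple: "i \<in> {1..m} \<Longrightarrow> tuple m x \<omega> ! (i - 1) = x i \<omega>"
  by (cases i) (simp_all add: tuple_def del: upt_Suc)

lemma simple_function_tuple:
  assumes "\<And>i. i \<in> {1..m} \<Longrightarrow> simple_function M (x i)"
  shows "simple_function M (tuple m x)"
  using assms
proof (induction m)
  case 0
  have "tuple 0 x = (\<lambda>_. [])" by (simp add: tuple_def fun_eq_iff)
  then show ?case by simp
next
  case (Suc m)
  have "tuple (Suc m) x = (\<lambda>\<omega>. tuple m x \<omega> @ [x (Suc m) \<omega>])"
    by (simp add: tuple_def fun_eq_iff)
  moreover have "simple_function M (\<lambda>\<omega>. tuple m x \<omega> @ [x (Suc m) \<omega>])"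
    using Suc by (intro simple_function_compose2[where h = "\<lambda>u v. u @ [v]"]) auto
  ultimately show ?case by simp
qed

text \<open>If node \<open>k\<close> broadcasts the offset \<open>c\<close>, then its virtual node \<open>(k, j)\<close> is treated as
  demanding function \<open>offset_demand Q c j\<close>. The offset makes the virtual node selected by the local
  randomness demand the assigned function.\<close>

definition demand_offset :: "nat \<Rightarrow> nat \<Rightarrow> nat \<Rightarrow> nat" where
  "demand_offset Q q j = (q + (Q - j)) mod Q"

definition offset_demand :: "nat \<Rightarrow> nat \<Rightarrow> nat \<Rightarrow> nat" where
  "offset_demand Q c j = (j - 1 + c) mod Q + 1"

lemma offset_demand_offset:
  assumes "q \<in> {1..Q}" "j \<in> {1..Q}"
  shows "offset_demand Q (demand_offset Q q j) j = q"
proof -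
  have "(j - 1 + (q + (Q - j)) mod Q) mod Q = (j - 1 + (q + (Q - j))) mod Q"
    by (rule mod_add_right_eq)
  \<comment> \<open>The truncated subtractions are exact because \<open>q\<close> and
    \<open>j\<close> lie in \<open>{1..Q}\<close>.\<close>
  also have "j - 1 + (q + (Q - j)) = q - 1 + Q"
    using assms by auto
  also have "\<dots> mod Q = q - 1"
    using assms by (subst mod_add_self2) auto
  finally show ?thesis
    using assms by (simp add: offset_demand_def demand_offset_def del: mod_add_right_eq)
qed

text \<open>The source of privacy: for each fixed function \<open>q\<close>, a uniform column
  \<open>j\<close> gives a uniform offset, so the offset alone says nothing about \<open>q\<close>.
  The map is \<open>q - j\<close> modulo \<open>Q\<close>.\<close>

lemma demand_offset_bij:
  assumes "0 < Q"
  shows "bij_betw (demand_offset Q q) {1..Q} {..<Q}"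
proof -
  have inj: "inj_on (demand_offset Q q) {1..Q}"
  proof (rule inj_onI)
    fix i j assume ij: "i \<in> {1..Q}" "j \<in> {1..Q}" "demand_offset Q q i = demand_offset Q q j"
    then obtain n1 n2 where "q + (Q - i) + Q * n1 = q + (Q - j) + Q * n2"
      unfolding demand_offset_def by (auto simp only: nat_mod_eq_iff)
    then have "Q - i + Q * n1 = Q - j + Q * n2" by simp
    then have "(Q - i) mod Q = (Q - j) mod Q" by (metis mod_mult_self2)
    then show "i = j" using ij by auto
  qed
  moreover have "demand_offset Q q ` {1..Q} \<subseteq> {..<Q}"
    using assms by (auto simp: demand_offset_def)
  ultimately show ?thesis
    by (simp add: bij_betw_def card_image card_subset_eq)
qed

section \<open>Privacy of the offsets\<close>

context private_cdc
begin

lemma prob_uniform_on_functions: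
  assumes a: "uniform_on_functions a" "simple_function M (a k)"
    and k: "k \<in> {1..K}" and j: "j \<in> {1..Q}"
  shows "prob (a k -` {j} \<inter> space M) = 1 / real Q"
proof -
  have "a k \<in> measurable M (count_space {1..Q})"
    using a k simple_functionD(2)[OF a(2)]
    by (subst measurable_count_space_eq2) (auto simp: uniform_on_functions_def)
  then have "prob (a k -` {j} \<inter> space M) = measure (distr M (count_space {1..Q}) (a k)) {j}"
    using j by (subst measure_distr) auto
  also have "\<dots> = measure (uniform_count_measure {1..Q}) {j}"
    using a k by (simp add: uniform_on_functions_def)
  also have "\<dots> = 1 / real Q"
    using j by (subst measure_uniform_count_measure) auto
  finally show ?thesis .
qed

text \<open>Given the files, the assignment and \<open>a k\<close>, the offsets of the other nodes are independent
  and uniform, whereas the offset of node \<open>k\<close> is a function of its assignment and of its storage,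
  which reveals \<open>a k\<close>.\<close>

lemma offsets_private:
  fixes a :: "nat \<Rightarrow> 'a \<Rightarrow> nat" and m :: "'a \<Rightarrow> 'm"
  assumes lr: "local_randomness a" and unif: "uniform_on_functions a" and k: "k \<in> {1..K}"
    and m: "\<And>\<omega> \<omega>'. \<omega> \<in> space M \<Longrightarrow> \<omega>' \<in> space M \<Longrightarrow> a k \<omega> = a k \<omega>' \<Longrightarrow>
              tuple N W \<omega> = tuple N W \<omega>' \<Longrightarrow> m \<omega> = m \<omega>'"
    and reveal: "\<And>\<omega> \<omega>'. \<omega> \<in> space M \<Longrightarrow> \<omega>' \<in> space M \<Longrightarrow> m \<omega> = m \<omega>' \<Longrightarrow> a k \<omega> = a k \<omega>'"
  defines "y \<equiv> \<lambda>k \<omega>. [demand_offset Q (d k \<omega>) (a k \<omega>)]"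
  shows "\<I>(tuple K d ; tuple K y | (\<lambda>\<omega>. (d k \<omega>, m \<omega>))) = 0"
proof (rule conditional_mutual_information_eq_0)
  have sa: "simple_function M (a j)" if "j \<in> {1..K}" for j
    using lr that by (simp add: local_randomness_def)
  have a_in: "a j \<omega> \<in> {1..Q}" if "j \<in> {1..K}" "\<omega> \<in> space M" for j \<omega>
    using unif that by (simp add: uniform_on_functions_def)
  have sW: "simple_function M (tuple N W)"
    by (rule simple_function_tuple) (rule files)
  show "simple_function M (tuple K d)"
    by (rule simple_function_tuple) (rule assignment)
  show "simple_function M (tuple K y)"
    unfolding y_def
    by (intro simple_function_tuple simple_function_compose2[where h = "\<lambda>u v. [demand_offset Q u v]"]
        assignment sa)
  have "simple_function M m"
    by (rule simple_function_determined[OF simple_function_Pair[OF sa[OF k] sW]], rule m) auto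
  then show "simple_function M (\<lambda>\<omega>. (d k \<omega>, m \<omega>))"
    by (intro simple_function_Pair assignment k)
  let ?Z = "\<lambda>\<omega>. (d k \<omega>, m \<omega>)" and ?C = "\<lambda>\<omega>. (tuple N W \<omega>, tuple K d \<omega>)"
  \<comment> \<open>\<open>?ok\<close> describes the query vectors compatible with the condition:
    offsets below \<open>Q\<close> for the other nodes, and for node \<open>k\<close> the value
    taken at some outcome with \<open>?Z = z\<close>. Each of them has conditional probability
    \<open>(1 / Q) ^ (K - 1)\<close>.\<close>
  let ?ok = "\<lambda>u z. length u = K \<and> (\<forall>j\<in>{1..K} - {k}. \<exists>v<Q. u ! (j - 1) = [v]) \<and>
                (\<exists>\<omega>\<in>space M. ?Z \<omega> = z \<and> u ! (k - 1) = y k \<omega>)"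
  let ?c = "\<lambda>u z. if ?ok u z then (1 / real Q) ^ (K - 1) else 0"
  fix x u z
  let ?E = "{\<omega> \<in> space M. tuple K d \<omega> = x \<and> ?Z \<omega> = z}"
    and ?E' = "{\<omega> \<in> space M. tuple K d \<omega> = x \<and> tuple K y \<omega> = u \<and> ?Z \<omega> = z}"
  show "prob ?E' = ?c u z * prob ?E"
  proof (cases "?ok u z \<and> ?E \<noteq> {}")
    \<comment> \<open>Both sides are 0: every outcome of \<open>?E'\<close> makes \<open>u\<close>
      compatible with \<open>z\<close> and lies in \<open>?E\<close>.\<close>
    case False
    have "?ok u z" if "\<omega> \<in> ?E'" for \<omega>
    proof -
      from that have w: "\<omega> \<in> space M" "?Z \<omega> = z" "u = tuple K y \<omega>" by auto
      then have "u ! (j - 1) = y j \<omega>" if "j \<in> {1..K}" for j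
        using nth_tuple[OF that] by simp
      moreover have "demand_offset Q (d j \<omega>) (a j \<omega>) < Q" for j
        using pos by (simp add: demand_offset_def)
      ultimately show ?thesis
        using w k unfolding y_def by (intro conjI) (simp, blast+)
    qed
    then have "?E' = {}" if "\<not> ?ok u z" using that by blast
    moreover have "?E' = {}" if "?E = {}" using that by blast
    ultimately show ?thesis using False by (smt (verit) measure_empty mult_eq_0_iff)
  next
    case True
    then have length_u: "length u = K"
      and entries_u: "\<forall>j\<in>{1..K} - {k}. \<exists>v<Q. u ! (j - 1) = [v]"
      and Z_u: "\<exists>\<omega>\<in>space M. ?Z \<omega> = z \<and> u ! (k - 1) = y k \<omega>" and E_ne: "?E \<noteq> {}"
      by - (elim conjE, assumption)+
    from Z_u obtain \<omega>1 where \<omega>1: "\<omega>1 \<in> space M" "?Z \<omega>1 = z" "u ! (k - 1) = y k \<omega>1" by blast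
    obtain \<omega>2 where \<omega>2: "\<omega>2 \<in> space M" "tuple K d \<omega>2 = x" using E_ne by blast
    have Z: "a k \<omega> = a k \<omega>1" "u ! (k - 1) = y k \<omega>" if "\<omega> \<in> space M" "?Z \<omega> = z" for \<omega>
      using reveal[of \<omega> \<omega>1] that \<omega>1 by (auto simp: y_def)
    \<comment> \<open>With the assignment fixed to \<open>x\<close>, as at \<open>\<omega>2\<close>,
      a prescribed offset of node \<open>j\<close> amounts to one prescribed value
      \<open>i j\<close> of its local randomness.\<close>
    have "\<exists>i. i \<in> {1..Q} \<and> u ! (j - 1) = [demand_offset Q (d j \<omega>2) i]" if j: "j \<in> {1..K} - {k}" for j
    proof -
      obtain v where v: "v < Q" "u ! (j - 1) = [v]" using bspec[OF entries_u j] by blast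
      then have "v \<in> demand_offset Q (d j \<omega>2) ` {1..Q}"
        using demand_offset_bij[of Q "d j \<omega>2"] pos by (auto simp: bij_betw_def)
      then show ?thesis using v by auto
    qed
    then obtain i where i: "\<And>j. j \<in> {1..K} - {k} \<Longrightarrow> i j \<in> {1..Q}"
      "\<And>j. j \<in> {1..K} - {k} \<Longrightarrow> u ! (j - 1) = [demand_offset Q (d j \<omega>2) (i j)]"
      by metis
    \<comment> \<open>Both events are written as intersections of events \<open>A j\<close>, one
      from each independent algebra. \<open>A 0\<close> keeps of \<open>?E\<close> only what the
      files and the assignment tell.\<close>
    define A where "A j = (if j = 0 then ?C -` (?C ` ?E) \<inter> space M
        else if j = k then a k -` {a k \<omega>1} \<inter> space M else a j -` {i j} \<inter> space M)" for j
    define G where "G j = (if j = 0 then range (\<lambda>A. ?C -` A \<inter> space M)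
        else range (\<lambda>A. a j -` A \<inter> space M))" for j
    have A: "A j \<in> G j" for j
      unfolding A_def G_def by (auto simp del: vimage_insert)
    have "indep_sets G {0..K}"
      using lr unfolding local_randomness_def G_def by blast
    then have indep: "prob (\<Inter>j\<in>J. A j) = (\<Prod>j\<in>J. prob (A j))" if "J \<subseteq> {0..K}" "J \<noteq> {}" for J
      by (rule indep_setsD) (use that A in \<open>auto intro: finite_subset\<close>)
    \<comment> \<open>An outcome in \<open>A 0\<close> and \<open>A k\<close> shares files and
      assignment with an outcome of \<open>?E\<close>, and also the value of \<open>a k\<close>;
      hence it has the same \<open>m\<close>.\<close>
    have E: "?E = (\<Inter>j\<in>{0, k}. A j)"
    proof (intro equalityI subsetI)
      fix \<omega> assume "\<omega> \<in> ?E"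
      then show "\<omega> \<in> (\<Inter>j\<in>{0, k}. A j)" using Z(1)[of \<omega>] k by (auto simp: A_def)
    next
      fix \<omega> assume "\<omega> \<in> (\<Inter>j\<in>{0, k}. A j)"
      then have w: "\<omega> \<in> space M" "a k \<omega> = a k \<omega>1" and "?C \<omega> \<in> ?C ` ?E"
        using k by (auto simp: A_def)
      then obtain \<omega>3 where w3: "\<omega>3 \<in> ?E" "?C \<omega> = ?C \<omega>3" by blast
      have "m \<omega> = m \<omega>3"
        using m[of \<omega> \<omega>3] w w3 Z(1)[of \<omega>3] by auto
      moreover have "d k \<omega> = d k \<omega>3"
        using w3 k by (auto simp: tuple_eq_iff)
      ultimately show "\<omega> \<in> ?E" using w w3 by auto
    qed
    have E': "?E' = (\<Inter>j\<in>{0..K}. A j)"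
    proof -
      have in_A: "\<omega> \<in> (\<Inter>j\<in>{0..K}. A j) \<longleftrightarrow> \<omega> \<in> ?E \<and> (\<forall>j\<in>{1..K} - {k}. a j \<omega> = i j)" for \<omega>
      proof -
        have "{0..K} = {0, k} \<union> ({1..K} - {k})" using k by auto
        then have "(\<Inter>j\<in>{0..K}. A j) = ?E \<inter> (\<Inter>j\<in>{1..K} - {k}. A j)"
          unfolding E by (simp only: INF_union)
        then show ?thesis by (auto simp: A_def)
      qed
      have tuple_u: "tuple K y \<omega> = u \<longleftrightarrow> (\<forall>j\<in>{1..K} - {k}. a j \<omega> = i j)" if w: "\<omega> \<in> ?E" for \<omega>
      proof -
        have "tuple K y \<omega> = u \<longleftrightarrow> (\<forall>j\<in>{1..K}. y j \<omega> = u ! (j - 1))"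
        proof
          assume *: "\<forall>j\<in>{1..K}. y j \<omega> = u ! (j - 1)"
          show "tuple K y \<omega> = u"
          proof (rule nth_equalityI)
            fix n assume "n < length (tuple K y \<omega>)"
            then have "Suc n \<in> {1..K}" by simp
            then show "tuple K y \<omega> ! n = u ! n"
              using * nth_tuple[of "Suc n" K y \<omega>] by simp
          qed (simp add: length_u)
        qed (use nth_tuple in metis)
        also have "\<dots> \<longleftrightarrow> (\<forall>j\<in>{1..K} - {k}. y j \<omega> = u ! (j - 1))"
          using Z(2)[of \<omega>] w by auto
        also have "\<dots> \<longleftrightarrow> (\<forall>j\<in>{1..K} - {k}. a j \<omega> = i j)"
        proof (rule ball_cong[OF refl])
          fix j assume j: "j \<in> {1..K} - {k}"
          have "d j \<omega> = d j \<omega>2"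
            using w \<omega>2 j tuple_eq_iff[of K d \<omega> \<omega>2] by auto
          moreover have "demand_offset Q (d j \<omega>2) (a j \<omega>) = demand_offset Q (d j \<omega>2) (i j) \<longleftrightarrow> a j \<omega> = i j"
            using demand_offset_bij[of Q "d j \<omega>2"] pos i(1)[OF j] a_in[of j \<omega>] j w
            by (auto simp: bij_betw_def dest: inj_onD)
          ultimately show "y j \<omega> = u ! (j - 1) \<longleftrightarrow> a j \<omega> = i j"
            using i(2)[OF j] by (simp add: y_def)
        qed
        finally show ?thesis .
      qed
      have "?E' = {\<omega> \<in> ?E. tuple K y \<omega> = u}" by auto
      also have "\<dots> = {\<omega> \<in> ?E. \<forall>j\<in>{1..K} - {k}. a j \<omega> = i j}"
        using tuple_u by (intro Collect_cong conj_cong refl)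
      also have "\<dots> = (\<Inter>j\<in>{0..K}. A j)"
        using in_A by (intro set_eqI) simp
      finally show ?thesis .
    qed
    have "prob ?E' = (\<Prod>j\<in>{0..K}. prob (A j))"
      unfolding E' by (rule indep) auto
    \<comment> \<open>The factors for 0 and \<open>k\<close> recombine to the probability of
      \<open>?E\<close>; each of the other \<open>K - 1\<close> nodes contributes
      \<open>1 / Q\<close>.\<close>
    also have "\<dots> = (\<Prod>j\<in>{1..K} - {k}. prob (A j)) * (\<Prod>j\<in>{0, k}. prob (A j))"
      using k by (subst prod.subset_diff[of "{0, k}"]) (auto intro!: prod.cong)
    also have "(\<Prod>j\<in>{1..K} - {k}. prob (A j)) = (\<Prod>j\<in>{1..K} - {k}. 1 / real Q)"
      using prob_uniform_on_functions[OF unif sa] i(1) by (intro prod.cong) (auto simp: A_def)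
    also have "\<dots> = (1 / real Q) ^ (K - 1)"
      using k by simp
    also have "(\<Prod>j\<in>{0, k}. prob (A j)) = prob ?E"
      unfolding E using k by (intro indep[symmetric]) auto
    finally show ?thesis using True by simp
  qed
qed

end

section \<open>The scheme\<close>

text \<open>Decoding by cancellation modulo 2: if two sums of bits agree and so do all their
  summands except one, then the remaining summands agree. Here \<open>p\<close> and
  \<open>p'\<close> will be the bits at two outcomes to be compared.\<close>

lemma odd_card_cancel:
  assumes "finite I" "z \<in> I" "\<And>x. x \<in> I \<Longrightarrow> x \<noteq> z \<Longrightarrow> p x \<longleftrightarrow> p' x"
    and odd: "odd (card {x \<in> I. p x}) \<longleftrightarrow> odd (card {x \<in> I. p' x})"
  shows "p z \<longleftrightarrow> p' z"
proof -
  have split: "card {x \<in> I. u x} = card {x \<in> I - {z}. u x} + of_bool (u z)" for u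
  proof -
    have "{x \<in> I. u x} = (if u z then insert z {x \<in> I - {z}. u x} else {x \<in> I - {z}. u x})"
      using assms(2) by auto
    then show ?thesis using assms(1) by simp
  qed
  have "{x \<in> I - {z}. p x} = {x \<in> I - {z}. p' x}"
    using assms(3) by auto
  then show ?thesis
    using odd unfolding split[of p] split[of p'] by (cases "p z"; cases "p' z") auto
qed

section \<open>Batches, storage, queries and coded sequences\<close>

text \<open>The divisibility conditions make all batches equally large and cut each batch string
  into \<open>r1\<close> equal pieces. \<open>extra\<close> stays arbitrary, so that the unpadded
  length can be computed first and the padding chosen from it.\<close>

locale coded_shuffle = private_cdc M K Q N w \<alpha> b W d g h
  for M :: "'a measure" and K Q N w \<alpha> b :: nat
    and W :: "nat \<Rightarrow> 'a \<Rightarrow> bool list" and d :: "nat \<Rightarrow> 'a \<Rightarrow> nat"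
    and g :: "nat \<Rightarrow> bool list \<Rightarrow> bool list" and h :: "nat \<Rightarrow> bool list list \<Rightarrow> bool list" +
  fixes r1 r2 extra :: nat and a :: "nat \<Rightarrow> 'a \<Rightarrow> nat"
  assumes r1: "r1 \<in> {1..K - 1}" and r2: "r2 \<in> {1..Q - 1}"
    and randomness: "local_randomness a" and uniform: "uniform_on_functions a"
    and F_dvd: "(K choose r1) * (Q choose r2) dvd N"
    and r1_dvd: "r1 dvd N div ((K choose r1) * (Q choose r2)) * \<alpha>"
begin

abbreviation "F \<equiv> (K choose r1) * (Q choose r2)"
abbreviation "\<eta> \<equiv> N div F"
abbreviation "P \<equiv> extended_pda K Q r1 r2"

definition "\<delta> = \<eta> * \<alpha> div r1"

lemma N_eq: "N = F * \<eta>"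
  using F_dvd by simp

lemma \<eta>_pos: "0 < \<eta>"
  using pos N_eq by (metis gr0I mult_0_right less_irrefl)

lemma \<delta>_eq: "r1 * \<delta> = \<eta> * \<alpha>"
  unfolding \<delta>_def using r1_dvd by simp

text \<open>Consecutive files form a batch. Selecting files by their block number makes disjointness
  immediate, whatever the index.\<close>

definition batch :: "nat \<Rightarrow> nat set" where
  "batch f = {n \<in> {1..N}. (n - 1) div \<eta> + 1 = f}"

lemma batch_eq_image:
  assumes "f \<in> {1..F}"
  shows "batch f = (\<lambda>i. (f - 1) * \<eta> + i) ` {1..\<eta>}"
proof (intro equalityI subsetI)
  fix n assume "n \<in> batch f"
  then have n: "n \<in> {1..F * \<eta>}" "(n - 1) div \<eta> + 1 = f"
    by (simp_all add: batch_def flip: N_eq)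
  from n(1) obtain f' i where fi: "f' \<in> {1..F}" "i \<in> {1..\<eta>}" "n = (f' - 1) * \<eta> + i"
    by (rule block_indexE)
  then have "f' = f"
    using n(2) block_index(1)[of f' i \<eta>] by simp
  then show "n \<in> (\<lambda>i. (f - 1) * \<eta> + i) ` {1..\<eta>}"
    using fi by blast
next
  fix n assume "n \<in> (\<lambda>i. (f - 1) * \<eta> + i) ` {1..\<eta>}"
  then obtain i where i: "i \<in> {1..\<eta>}" "n = (f - 1) * \<eta> + i" by blast
  then have "n \<in> {1..N}"
    using block_index_in[OF assms i(1)] N_eq by simp
  moreover have "(n - 1) div \<eta> + 1 = f"
    using assms i block_index(1)[of f i \<eta>] by simp
  ultimately show "n \<in> batch f" by (simp add: batch_def)
qed

lemma card_batch: "f \<in> {1..F} \<Longrightarrow> card (batch f) = \<eta>"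
  by (simp add: batch_eq_image card_image)

lemma disjoint_batch: "disjoint_family_on batch I"
  by (auto simp: disjoint_family_on_def batch_def)

lemma batch_le: "batch f \<subseteq> {1..N}"
  by (auto simp: batch_def)

lemma UN_batch: "(\<Union>f\<in>{1..F}. batch f) = {1..N}"
proof (intro equalityI subsetI)
  fix n assume n: "n \<in> {1..N}"
  then have "n \<in> {1..F * \<eta>}" using N_eq by simp
  then obtain f i where fi: "f \<in> {1..F}" "i \<in> {1..\<eta>}" "n = (f - 1) * \<eta> + i"
    by (rule block_indexE)
  then have "n \<in> batch f" by (simp only: batch_eq_image) blast
  then show "n \<in> (\<Union>f\<in>{1..F}. batch f)" using fi by blast
qed (use batch_le in blast)

definition stored :: "nat \<Rightarrow> 'a \<Rightarrow> nat set" where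
  "stored k \<omega> = (\<Union>f\<in>{f\<in>{1..F}. P f ((k - 1) * Q + a k \<omega>) = Star}. batch f)"

definition storage :: "nat \<Rightarrow> 'a \<Rightarrow> (nat \<rightharpoonup> bool list)" where
  "storage k \<omega> = (\<lambda>n. Some (W n \<omega>)) |` stored k \<omega>"

definition query :: "nat \<Rightarrow> 'a \<Rightarrow> nat list" where
  "query k \<omega> = [demand_offset Q (d k \<omega>) (a k \<omega>)]"

text \<open>It depends on the query only, so all nodes know it after the broadcast; the demands of
  columns that were not selected are fictitious.\<close>

definition demand :: "nat \<Rightarrow> nat \<Rightarrow> 'a \<Rightarrow> nat" where
  "demand k j \<omega> = offset_demand Q (hd (query k \<omega>)) j"

text \<open>The row of the extended array with outer label \<open>T1\<close> and inner label
  \<open>T2\<close>.\<close>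

definition batch_no :: "nat set \<Rightarrow> nat set \<Rightarrow> nat" where
  "batch_no T1 T2 = (lex_pos K r1 T1 - 1) * (Q choose r2) + lex_pos Q r2 T2"

text \<open>The intermediate values of a batch are concatenated to one string of \<open>\<eta> * \<alpha>\<close> bits,
  numbered from 1.\<close>

definition batch_bit :: "nat \<Rightarrow> nat \<Rightarrow> nat \<Rightarrow> 'a \<Rightarrow> bool" where
  "batch_bit q f x \<omega> = iv q ((f - 1) * \<eta> + ((x - 1) div \<alpha> + 1)) \<omega> ! ((x - 1) mod \<alpha>)"

text \<open>The string of a batch is cut into \<open>r1\<close> pieces of length \<open>\<delta>\<close>, one for each element of \<open>T1\<close>.\<close>

definition piece_bit :: "nat set \<Rightarrow> nat \<Rightarrow> nat \<Rightarrow> nat" where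
  "piece_bit T1 k p = card {i \<in> T1. i < k} * \<delta> + p"

text \<open>For every integer of the array, i.e. every pair \<open>(U1, U2)\<close>, each node \<open>k \<in> U1\<close> sends the sum
  of the \<open>k\<close>-th pieces over the occurrences of that integer in the block columns other than \<open>k\<close>.\<close>

definition coded_bit :: "nat \<Rightarrow> nat set \<times> nat set \<times> nat \<Rightarrow> 'a \<Rightarrow> bool" where
  "coded_bit k = (\<lambda>(U1, U2, p) \<omega>. odd (card {z \<in> (U1 - {k}) \<times> U2.
      batch_bit (demand (fst z) (snd z) \<omega>) (batch_no (U1 - {fst z}) (U2 - {snd z}))
        (piece_bit (U1 - {fst z}) k p) \<omega>}))"

definition coded_positions :: "nat \<Rightarrow> (nat set \<times> nat set \<times> nat) set" where
  "coded_positions k =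
     {U \<in> subsets_of_size K (r1 + 1). k \<in> U} \<times> subsets_of_size Q (r2 + 1) \<times> {1..\<delta>}"

text \<open>Any order of the positions will do, as long as it is the same at all outcomes.\<close>

definition coded_list :: "nat \<Rightarrow> (nat set \<times> nat set \<times> nat) list" where
  "coded_list k = (SOME xs. set xs = coded_positions k \<and> distinct xs)"

text \<open>Node 1 appends \<open>extra\<close> useless bits: for \<open>K < Q\<close> the scheme needs only the fraction \<open>K / Q\<close> of
  the claimed communication load.\<close>

definition coded_sequence :: "nat \<Rightarrow> 'a \<Rightarrow> bool list" where
  "coded_sequence k \<omega> =
     map (\<lambda>t. coded_bit k t \<omega>) (coded_list k) @ replicate (if k = 1 then extra else 0) False"

definition seq_length :: "nat \<Rightarrow> nat" where
  "seq_length k = card (coded_positions k) + (if k = 1 then extra else 0)"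

section \<open>What a node stores and what its storage reveals\<close>

lemma a_in: "k \<in> {1..K} \<Longrightarrow> \<omega> \<in> space M \<Longrightarrow> a k \<omega> \<in> {1..Q}"
  using uniform by (simp add: uniform_on_functions_def)

lemma coded_list: "set (coded_list k) = coded_positions k" "distinct (coded_list k)"
proof -
  have "finite (coded_positions k)" by (simp add: coded_positions_def)
  then have "\<exists>xs. set xs = coded_positions k \<and> distinct xs" by (rule finite_distinct_list)
  then have "set (coded_list k) = coded_positions k \<and> distinct (coded_list k)"
    unfolding coded_list_def by (rule someI_ex)
  then show "set (coded_list k) = coded_positions k" "distinct (coded_list k)" by auto
qed

lemma length_coded_sequence: "length (coded_sequence k \<omega>) = seq_length k"
  using distinct_card[OF coded_list(2)[of k]]
  by (simp add: coded_sequence_def seq_length_def coded_list(1))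

lemma batch_no_in:
  assumes "T1 \<in> subsets_of_size K r1" "T2 \<in> subsets_of_size Q r2"
  shows "batch_no T1 T2 \<in> {1..F}"
  unfolding batch_no_def by (rule block_index_in[OF lex_pos_in[OF assms(1)] lex_pos_in[OF assms(2)]])

lemma batch_noE:
  assumes "f \<in> {1..F}"
  obtains T1 T2 where "T1 \<in> subsets_of_size K r1" "T2 \<in> subsets_of_size Q r2" "f = batch_no T1 T2"
proof -
  obtain f1 f2 where f: "f1 \<in> {1..K choose r1}" "f2 \<in> {1..Q choose r2}"
    and eq: "f = (f1 - 1) * (Q choose r2) + f2"
    using assms by (rule block_indexE)
  show thesis
  proof (rule that[OF row_in[OF f(1)] row_in[OF f(2)]])
    show "f = batch_no (row K r1 f1) (row Q r2 f2)"
      unfolding batch_no_def lex_pos_row[OF f(1)] lex_pos_row[OF f(2)] by (rule eq)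
  qed
qed

lemma P_batch_no:
  assumes T: "T1 \<in> subsets_of_size K r1" "T2 \<in> subsets_of_size Q r2"
    and kj: "k \<in> {1..K}" "j \<in> {1..Q}"
  shows "P (batch_no T1 T2) ((k - 1) * Q + j) = Star \<longleftrightarrow> k \<in> T1 \<or> j \<in> T2"
proof -
  have "0 < lex_pos K r1 T1" "lex_pos Q r2 T2 \<in> {1..Q choose r2}" "0 < k"
    using lex_pos_in[OF T(1)] lex_pos_in[OF T(2)] kj by auto
  from substitute_block_eq_Star[OF this kj(2)] show ?thesis
    unfolding extended_pda_substitute batch_no_def
    by (simp add: subset_pda_row row_lex_pos[OF T(1)] row_lex_pos[OF T(2)])
qed

lemma batch_subset_stored:
  assumes "T1 \<in> subsets_of_size K r1" "T2 \<in> subsets_of_size Q r2"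
    and "k \<in> {1..K}" "\<omega> \<in> space M" "k \<in> T1 \<or> a k \<omega> \<in> T2"
  shows "batch (batch_no T1 T2) \<subseteq> stored k \<omega>"
  unfolding stored_def using batch_no_in[OF assms(1,2)] P_batch_no[OF assms(1-3) a_in[OF assms(3,4)]] assms(5)
  by blast

lemma stored_le: "stored k \<omega> \<subseteq> {1..N}"
  unfolding stored_def using batch_le by blast

lemma dom_storage [simp]: "dom (storage k \<omega>) = stored k \<omega>"
  by (auto simp: storage_def restrict_map_def dom_def)

lemma storage_eqD:
  assumes "storage k \<omega> = storage k \<omega>'" "n \<in> stored k \<omega>"
  shows "W n \<omega> = W n \<omega>'"
proof -
  have "n \<in> stored k \<omega>'" using assms dom_storage by metis
  then show ?thesis
    using fun_cong[OF assms(1), of n] assms(2) by (simp add: storage_def)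
qed

lemma storage_determined:
  assumes "a k \<omega> = a k \<omega>'" "tuple N W \<omega> = tuple N W \<omega>'"
  shows "storage k \<omega> = storage k \<omega>'"
proof
  fix n
  have "stored k \<omega> = stored k \<omega>'" using assms(1) by (simp add: stored_def)
  moreover have "W n \<omega> = W n \<omega>'" if "n \<in> stored k \<omega>"
    using that stored_le[of k \<omega>] assms(2) tuple_eq_iff[of N W \<omega> \<omega>'] by blast
  ultimately show "storage k \<omega> n = storage k \<omega>' n"
    by (cases "n \<in> stored k \<omega>") (simp_all add: storage_def)
qed

text \<open>Two different columns \<open>(k, j)\<close> and \<open>(k, j')\<close> of a node have
  different stars: take a row with \<open>k\<close> outside \<open>T1\<close> and with exactly one
  of the two functions in \<open>T2\<close>. Its batch is nonempty, so the stored index sets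
  differ.\<close>

lemma storage_reveals:
  assumes k: "k \<in> {1..K}" and \<omega>: "\<omega> \<in> space M" "\<omega>' \<in> space M"
    and eq: "storage k \<omega> = storage k \<omega>'"
  shows "a k \<omega> = a k \<omega>'"
proof (rule ccontr)
  assume ne: "a k \<omega> \<noteq> a k \<omega>'"
  note aQ = a_in[OF k \<omega>(1)] a_in[OF k \<omega>(2)]
  have "r1 \<le> card ({1..K} - {k})" using k r1 by simp
  then obtain T1 where T1: "T1 \<subseteq> {1..K} - {k}" "card T1 = r1"
    by (rule obtain_subset_with_card_n)
  \<comment> \<open>Leaving out both columns keeps \<open>Q - 2\<close> elements, enough as
    \<open>r2\<close> is less than \<open>Q\<close>; adding only \<open>a k \<omega>\<close> then
    separates the columns.\<close>
  have "r2 - 1 \<le> card ({1..Q} - {a k \<omega>, a k \<omega>'})"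
    using aQ ne r2 by (subst card_Diff_subset) auto
  then obtain T where T: "T \<subseteq> {1..Q} - {a k \<omega>, a k \<omega>'}" "card T = r2 - 1" "finite T"
    by (rule obtain_subset_with_card_n)
  define T2 where "T2 = insert (a k \<omega>) T"
  have S: "T1 \<in> subsets_of_size K r1" "T2 \<in> subsets_of_size Q r2"
    using T1 T aQ r2 by (auto simp: subsets_of_size_def T2_def card_insert_if)
  let ?f = "batch_no T1 T2"
  have f: "?f \<in> {1..F}" using S by (rule batch_no_in)
  have "batch ?f \<noteq> {}" using \<eta>_pos card_batch[OF f] by fastforce
  then obtain n where n: "n \<in> batch ?f" by blast
  have "n \<in> stored k \<omega>"
    using batch_subset_stored[OF S k \<omega>(1)] n by (auto simp: T2_def)
  then have "n \<in> stored k \<omega>'" using eq dom_storage by metis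
  \<comment> \<open>The file \<open>n\<close> belongs to the batch of one row only, so the star
    through which it is stored is in row \<open>?f\<close>.\<close>
  then have "P ?f ((k - 1) * Q + a k \<omega>') = Star"
    using n by (auto simp: stored_def batch_def)
  then have "k \<in> T1 \<or> a k \<omega>' \<in> T2"
    using P_batch_no[OF S k aQ(2)] by simp
  then show False using T1 T ne by (auto simp: T2_def)
qed

section \<open>Pieces, encoding and decoding\<close>

text \<open>The rank of a node in \<open>T1\<close> chooses the piece, and \<open>p\<close> the bit
  inside it. \<open>piece_bit\<close> counts strictly smaller elements, which is the rank minus 1 of
  the block numbering.\<close>

lemma piece_bit_bij:
  assumes "T1 \<in> subsets_of_size K r1"
  shows "bij_betw (\<lambda>(k, p). piece_bit T1 k p) (T1 \<times> {1..\<delta>}) {1..\<eta> * \<alpha>}"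
proof -
  have "bij_betw (\<lambda>k. card {i \<in> T1. i < k} + 1) T1 {1..card T1}"
    by (rule bij_betw_rank) (use subsets_of_sizeD(3)[OF assms] in auto)
  then have "bij_betw (\<lambda>k. card {i \<in> T1. i < k} + 1) T1 {1..r1}"
    by (simp only: subsets_of_sizeD(2)[OF assms])
  then have "bij_betw (map_prod (\<lambda>k. card {i \<in> T1. i < k} + 1) id) (T1 \<times> {1..\<delta>}) ({1..r1} \<times> {1..\<delta>})"
    by (intro bij_betw_map_prod) auto
  from bij_betw_trans[OF this block_index_bij[of \<delta> r1]]
  show ?thesis
    by (simp only: \<delta>_eq) (simp add: comp_def piece_bit_def case_prod_unfold)
qed

lemma piece_bit_in:
  assumes "T1 \<in> subsets_of_size K r1" "k \<in> T1" "p \<in> {1..\<delta>}"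
  shows "piece_bit T1 k p \<in> {1..\<eta> * \<alpha>}"
  using bij_betw_apply[OF piece_bit_bij[OF assms(1)], of "(k, p)"] assms by simp

text \<open>The comparison form of the fact that node \<open>k\<close> can compute this bit. The
  range of \<open>x\<close> keeps the file number inside the batch, where equal storages have equal
  contents.\<close>

lemma batch_bit_stored:
  assumes T: "T1 \<in> subsets_of_size K r1" "T2 \<in> subsets_of_size Q r2"
    and k: "k \<in> {1..K}" and \<omega>: "\<omega> \<in> space M" and star: "k \<in> T1 \<or> a k \<omega> \<in> T2"
    and eq: "storage k \<omega> = storage k \<omega>'" and x: "x \<in> {1..\<eta> * \<alpha>}"
  shows "batch_bit q (batch_no T1 T2) x \<omega> = batch_bit q (batch_no T1 T2) x \<omega>'"
proof -
  obtain i j where ij: "i \<in> {1..\<eta>}" "j \<in> {1..\<alpha>}" "x = (i - 1) * \<alpha> + j"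
    using x by (rule block_indexE)
  have "(x - 1) div \<alpha> + 1 = i" using ij block_index(1)[of i j \<alpha>] by simp
  then have "(batch_no T1 T2 - 1) * \<eta> + ((x - 1) div \<alpha> + 1) \<in> batch (batch_no T1 T2)"
    using ij(1) by (simp only: batch_eq_image[OF batch_no_in[OF T]]) blast
  then have "(batch_no T1 T2 - 1) * \<eta> + ((x - 1) div \<alpha> + 1) \<in> stored k \<omega>"
    using batch_subset_stored[OF T k \<omega> star] by blast
  from storage_eqD[OF eq this] show ?thesis
    by (simp only: batch_bit_def iv_def)
qed

lemma demand_determined:
  assumes "tuple K query \<omega> = tuple K query \<omega>'" "k \<in> {1..K}"
  shows "demand k j \<omega> = demand k j \<omega>'"
  using assms tuple_eq_iff[of K query \<omega> \<omega>'] by (simp add: demand_def)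

text \<open>The sender can compute every summand: the sum runs over block columns other than
  \<open>k\<close>, so \<open>k\<close> remains in the outer row label
  \<open>U1 - {fst z}\<close>.\<close>

lemma coded_sequence_determined:
  assumes k: "k \<in> {1..K}" and \<omega>: "\<omega> \<in> space M" and m: "storage k \<omega> = storage k \<omega>'"
    and y: "tuple K query \<omega> = tuple K query \<omega>'"
  shows "coded_sequence k \<omega> = coded_sequence k \<omega>'"
proof -
  have "coded_bit k t \<omega> = coded_bit k t \<omega>'" if "t \<in> set (coded_list k)" for t
  proof -
    obtain U1 U2 p where t: "t = (U1, U2, p)" by (cases t)
    then have U: "U1 \<in> subsets_of_size K (Suc r1)" "k \<in> U1" "U2 \<in> subsets_of_size Q (Suc r2)"
      "p \<in> {1..\<delta>}"
      using that unfolding coded_list(1) coded_positions_def by auto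
    have "batch_bit (demand (fst z) (snd z) \<omega>) (batch_no (U1 - {fst z}) (U2 - {snd z}))
            (piece_bit (U1 - {fst z}) k p) \<omega> =
          batch_bit (demand (fst z) (snd z) \<omega>') (batch_no (U1 - {fst z}) (U2 - {snd z}))
            (piece_bit (U1 - {fst z}) k p) \<omega>'" if z: "z \<in> (U1 - {k}) \<times> U2" for z
    proof -
      have f: "fst z \<in> U1" "fst z \<noteq> k" "snd z \<in> U2" using z by auto
      have T: "U1 - {fst z} \<in> subsets_of_size K r1" "U2 - {snd z} \<in> subsets_of_size Q r2"
        using remove_subsets_of_size[OF U(1) f(1)] remove_subsets_of_size[OF U(3) f(3)] .
      have kT: "k \<in> U1 - {fst z}" using U(2) f(2) by blast
      have "fst z \<in> {1..K}" using f(1) subsets_of_sizeD(1)[OF U(1)] by blast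
      from demand_determined[OF y this] show ?thesis
        using batch_bit_stored[OF T k \<omega> disjI1[OF kT] m piece_bit_in[OF T(1) kT U(4)]] by simp
    qed
    then show ?thesis
      unfolding t coded_bit_def prod.case by (intro arg_cong[where f = "\<lambda>A. odd (card A)"] Collect_cong conj_cong refl)
  qed
  then show ?thesis by (simp add: coded_sequence_def)
qed

text \<open>Decoding, bit by bit over the batch containing \<open>n\<close>. A stored batch is
  immediate; otherwise each bit lies in the piece of some \<open>k' \<in> T1\<close> and is the only
  summand unknown to \<open>k\<close> in a coded bit of \<open>k'\<close>.\<close>

lemma iv_determined:
  assumes k: "k \<in> {1..K}" and \<omega>: "\<omega> \<in> space M" "\<omega>' \<in> space M" and m: "storage k \<omega> = storage k \<omega>'"
    and a: "a k \<omega> = a k \<omega>'" and d: "d k \<omega> = d k \<omega>'"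
    and y: "tuple K query \<omega> = tuple K query \<omega>'"
    and X: "tuple K coded_sequence \<omega> = tuple K coded_sequence \<omega>'"
    and n: "n \<in> {1..N}"
  shows "iv (d k \<omega>) n \<omega> = iv (d k \<omega>) n \<omega>'"
proof -
  have "n \<in> {1..F * \<eta>}" using n N_eq by simp
  then obtain f i where f: "f \<in> {1..F}" and i: "i \<in> {1..\<eta>}" and n_eq: "n = (f - 1) * \<eta> + i"
    by (rule block_indexE)
  obtain T1 T2 where T: "T1 \<in> subsets_of_size K r1" "T2 \<in> subsets_of_size Q r2"
    and f_eq: "f = batch_no T1 T2"
    using f by (rule batch_noE)
  have dQ: "d k \<omega> \<in> {1..Q}" by (rule assignment(2)[OF k \<omega>(1)])
  have len: "length (iv (d k \<omega>) n \<omega>) = \<alpha>" "length (iv (d k \<omega>) n \<omega>') = \<alpha>"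
    unfolding iv_def using dQ files(2)[OF n \<omega>(1)] files(2)[OF n \<omega>(2)] by (auto intro: map_functions)
  have "batch_bit (d k \<omega>) f x \<omega> = batch_bit (d k \<omega>) f x \<omega>'" if x: "x \<in> {1..\<eta> * \<alpha>}" for x
  proof (cases "k \<in> T1 \<or> a k \<omega> \<in> T2")
    case True
    show ?thesis unfolding f_eq by (rule batch_bit_stored[OF T k \<omega>(1) True m x])
  next
    case False
    have "x \<in> (\<lambda>(k, p). piece_bit T1 k p) ` (T1 \<times> {1..\<delta>})"
      using x by (simp only: bij_betw_imp_surj_on[OF piece_bit_bij[OF T(1)]])
    then obtain k' p where k': "k' \<in> T1" and p: "p \<in> {1..\<delta>}" and x_eq: "x = piece_bit T1 k' p"
      by auto
    \<comment> \<open>These sets label the integer at row \<open>(T1, T2)\<close> in the selected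
      column of node \<open>k\<close>.\<close>
    define U1 U2 where "U1 = insert k T1" and "U2 = insert (a k \<omega>) T2"
    have U: "U1 \<in> subsets_of_size K (Suc r1)" "U2 \<in> subsets_of_size Q (Suc r2)"
      unfolding U1_def U2_def using False k a_in[OF k \<omega>(1)]
      by (auto intro: insert_subsets_of_size[OF T(1)] insert_subsets_of_size[OF T(2)])
    have kk': "k \<noteq> k'" using False k' by blast
    have k'K: "k' \<in> {1..K}" using k' subsets_of_sizeD(1)[OF T(1)] by blast
    have "(U1, U2, p) \<in> set (coded_list k')"
      unfolding coded_list(1) coded_positions_def using U p k' by (simp add: U1_def)
    moreover have "coded_sequence k' \<omega> = coded_sequence k' \<omega>'"
      using X k'K tuple_eq_iff[of K coded_sequence \<omega> \<omega>'] by blast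
    ultimately have "coded_bit k' (U1, U2, p) \<omega> = coded_bit k' (U1, U2, p) \<omega>'"
      by (simp add: coded_sequence_def)
    then have odd: "odd (card {z \<in> (U1 - {k'}) \<times> U2.
          batch_bit (demand (fst z) (snd z) \<omega>) (batch_no (U1 - {fst z}) (U2 - {snd z}))
            (piece_bit (U1 - {fst z}) k' p) \<omega>}) \<longleftrightarrow>
        odd (card {z \<in> (U1 - {k'}) \<times> U2.
          batch_bit (demand (fst z) (snd z) \<omega>') (batch_no (U1 - {fst z}) (U2 - {snd z}))
            (piece_bit (U1 - {fst z}) k' p) \<omega>'})"
      by (simp only: coded_bit_def prod.case)
    have fin: "finite ((U1 - {k'}) \<times> U2)"
      using subsets_of_sizeD(3)[OF U(1)] subsets_of_sizeD(3)[OF U(2)] by simp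
    have mem: "(k, a k \<omega>) \<in> (U1 - {k'}) \<times> U2"
      using kk' by (simp add: U1_def U2_def)
    have other: "batch_bit (demand (fst z) (snd z) \<omega>) (batch_no (U1 - {fst z}) (U2 - {snd z}))
            (piece_bit (U1 - {fst z}) k' p) \<omega> \<longleftrightarrow>
          batch_bit (demand (fst z) (snd z) \<omega>') (batch_no (U1 - {fst z}) (U2 - {snd z}))
            (piece_bit (U1 - {fst z}) k' p) \<omega>'"
      if z: "z \<in> (U1 - {k'}) \<times> U2" "z \<noteq> (k, a k \<omega>)" for z
    proof -
      have f: "fst z \<in> U1" "fst z \<noteq> k'" "snd z \<in> U2" using z by auto
      have T: "U1 - {fst z} \<in> subsets_of_size K r1" "U2 - {snd z} \<in> subsets_of_size Q r2"
        using remove_subsets_of_size[OF U(1) f(1)] remove_subsets_of_size[OF U(2) f(3)] .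
      have k'T: "k' \<in> U1 - {fst z}" using k' f(2) by (simp add: U1_def)
      \<comment> \<open>Another summand comes from another block column, which leaves
        \<open>k\<close> in the outer label, or from block column \<open>k\<close> with another
        function, which leaves \<open>a k \<omega>\<close> in the inner one.\<close>
      have star: "k \<in> U1 - {fst z} \<or> a k \<omega> \<in> U2 - {snd z}"
        using z(2) by (cases z) (auto simp: U1_def U2_def)
      have "fst z \<in> {1..K}" using f(1) subsets_of_sizeD(1)[OF U(1)] by blast
      from demand_determined[OF y this] show ?thesis
        using batch_bit_stored[OF T k \<omega>(1) star m piece_bit_in[OF T(1) k'T p]] by simp
    qed
    \<comment> \<open>The offset makes the selected column demand the assigned function, so the
      isolated summand is a bit of the wanted value.\<close>
    have "demand k (a k \<omega>) \<omega> = d k \<omega>"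
      using offset_demand_offset[OF dQ a_in[OF k \<omega>(1)]] by (simp add: demand_def query_def)
    moreover have "demand k (a k \<omega>) \<omega>' = d k \<omega>"
      using calculation demand_determined[OF y k] by simp
    moreover have "U1 - {k} = T1" "U2 - {a k \<omega>} = T2"
      using False by (auto simp: U1_def U2_def)
    ultimately show ?thesis
      using odd_card_cancel[OF fin mem other odd] by (simp add: x_eq f_eq)
  qed
  then have "iv (d k \<omega>) n \<omega> ! j = iv (d k \<omega>) n \<omega>' ! j" if j: "j < \<alpha>" for j
  proof -
    \<comment> \<open>List positions start at 0 and batch bits at 1: position \<open>j\<close> in
      the \<open>i\<close>-th value of the batch is bit
      \<open>(i - 1) * \<alpha> + Suc j\<close>.\<close>
    have "Suc j \<in> {1..\<alpha>}" using j by simp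
    note x = block_index_in[OF i this] and eq = block_index[of i "Suc j" \<alpha>]
    from \<open>\<And>x. x \<in> {1..\<eta> * \<alpha>} \<Longrightarrow> batch_bit (d k \<omega>) f x \<omega> = batch_bit (d k \<omega>) f x \<omega>'\<close>[OF x]
    show ?thesis
      using eq i j unfolding batch_bit_def n_eq by simp
  qed
  then show ?thesis by (intro nth_equalityI) (simp_all add: len)
qed

lemma \<phi>_determined:
  assumes "k \<in> {1..K}" "\<omega> \<in> space M" "\<omega>' \<in> space M" "storage k \<omega> = storage k \<omega>'"
    and "a k \<omega> = a k \<omega>'" "d k \<omega> = d k \<omega>'" "tuple K query \<omega> = tuple K query \<omega>'"
    and "tuple K coded_sequence \<omega> = tuple K coded_sequence \<omega>'"
  shows "\<phi> (d k \<omega>) \<omega> = \<phi> (d k \<omega>') \<omega>'"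
proof -
  have "tuple N (iv (d k \<omega>)) \<omega> = tuple N (iv (d k \<omega>)) \<omega>'"
    unfolding tuple_eq_iff using iv_determined[OF assms] by blast
  then show ?thesis using assms(6) by (simp add: \<phi>_def)
qed

section \<open>The conditions of the model and the correspondence to the array\<close>

lemma cdc_scheme: "cdc_scheme a storage query coded_sequence seq_length"
proof -
  have sa: "simple_function M (a k)" if "k \<in> {1..K}" for k
    using randomness that by (simp add: local_randomness_def)
  have sW: "simple_function M (tuple N W)"
    by (rule simple_function_tuple) (rule files)
  have sm: "simple_function M (storage k)" if "k \<in> {1..K}" for k
    by (rule simple_function_determined[OF simple_function_Pair[OF sa[OF that] sW]], rule storage_determined) auto
  have sy: "simple_function M (query k)" if "k \<in> {1..K}" for k
    unfolding query_def
    by (rule simple_function_compose2[where h = "\<lambda>u v. [demand_offset Q u v]", OF assignment(1)[OF that] sa[OF that]])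
  have sty: "simple_function M (tuple K query)"
    using sy by (rule simple_function_tuple)
  have sX: "simple_function M (coded_sequence k)" if "k \<in> {1..K}" for k
    by (rule simple_function_determined[OF simple_function_Pair[OF sm[OF that] sty]],
        rule coded_sequence_determined[OF that]) auto
  have stX: "simple_function M (tuple K coded_sequence)"
    using sX by (rule simple_function_tuple)
  show ?thesis
    unfolding cdc_scheme_def
  proof (intro conjI ballI)
    show "local_randomness a" by (rule randomness)
  next
    fix k assume k: "k \<in> {1..K}"
    show "simple_function M (storage k)" "simple_function M (query k)"
      "simple_function M (coded_sequence k)"
      using k by (rule sm sy sX)+
    show "\<H>(storage k | (\<lambda>\<omega>. (a k \<omega>, tuple N W \<omega>))) = 0"
      by (rule conditional_entropy_determined[OF simple_function_Pair[OF sa[OF k] sW]],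
          rule storage_determined) auto
    show "\<H>(query k | (\<lambda>\<omega>. (a k \<omega>, storage k \<omega>, d k \<omega>))) = 0"
      by (rule conditional_entropy_determined)
        (auto simp: query_def intro!: simple_function_Pair sa[OF k] sm[OF k] assignment(1)[OF k])
    show "\<I>(tuple K d ; tuple K query | (\<lambda>\<omega>. (d k \<omega>, storage k \<omega>))) = 0"
      unfolding query_def
      by (rule offsets_private[OF randomness uniform k storage_determined storage_reveals[OF k]])
    show "\<H>(coded_sequence k | (\<lambda>\<omega>. (storage k \<omega>, a k \<omega>, tuple K query \<omega>))) = 0"
      by (rule conditional_entropy_determined[OF simple_function_Pair[OF sm[OF k] simple_function_Pair[OF sa[OF k] sty]]],
          rule coded_sequence_determined[OF k]) auto
    show "\<H>((\<lambda>\<omega>. \<phi> (d k \<omega>) \<omega>) | (\<lambda>\<omega>. (storage k \<omega>, a k \<omega>, d k \<omega>, tuple K query \<omega>, tuple K coded_sequence \<omega>))) = 0"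
      by (rule conditional_entropy_determined[OF simple_function_Pair[OF sm[OF k] simple_function_Pair[OF sa[OF k]
            simple_function_Pair[OF assignment(1)[OF k] simple_function_Pair[OF sty stX]]]]],
          rule \<phi>_determined[OF k]) auto
  next
    fix k \<omega>
    show "\<exists>I\<subseteq>{1..N}. storage k \<omega> = (\<lambda>n. Some (W n \<omega>)) |` I"
      using stored_le[of k \<omega>] storage_def[of k \<omega>] by blast
    show "length (coded_sequence k \<omega>) = seq_length k"
      by (rule length_coded_sequence)
  qed
qed

lemma pda_corresponds: "pda_corresponds F P a storage"
  unfolding pda_corresponds_def
proof (intro conjI exI ballI)
  show "uniform_on_functions a" "F dvd N" by (rule uniform F_dvd)+
  show "disjoint_family_on batch {1..F}" by (rule disjoint_batch)
  show "(\<Union>f\<in>{1..F}. batch f) = {1..N}" by (rule UN_batch)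
  show "card (batch f) = \<eta>" if "f \<in> {1..F}" for f using that by (rule card_batch)
  show "dom (storage k \<omega>) = (\<Union>f\<in>{f \<in> {1..F}. P f ((k - 1) * Q + a k \<omega>) = Star}. batch f)" for k \<omega>
    unfolding dom_storage stored_def ..
qed

section \<open>Computation and communication loads\<close>

text \<open>All columns have \<open>Z\<close> stars, so the load is the same at every outcome,
  namely \<open>K * Z / F\<close>; absorption in both binomials of \<open>F\<close> cancels the
  common factor of \<open>Z\<close>.\<close>

lemma computation_load:
  assumes \<omega>: "\<omega> \<in> space M"
  shows "computation_load storage \<omega> = real r1 + (real K - real r1) * real r2 / real Q"
proof -
  define Z where "Z = ((K - 1) choose (r1 - 1)) * (Q choose r2) +
                ((K choose r1) - ((K - 1) choose (r1 - 1))) * ((Q - 1) choose (r2 - 1))"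
  note ext = extended_pda_is_pda[OF r1 r2, folded Z_def]
  have "card (stored k \<omega>) = Z * \<eta>" if k: "k \<in> {1..K}" for k
  proof -
    let ?S = "{f \<in> {1..F}. P f ((k - 1) * Q + a k \<omega>) = Star}"
    have "card (stored k \<omega>) = (\<Sum>f\<in>?S. card (batch f))"
      unfolding stored_def
      by (rule card_UN_disjoint) (auto simp: batch_def)
    also have "\<dots> = (\<Sum>f\<in>?S. \<eta>)"
      by (rule sum.cong) (auto simp: card_batch)
    also have "\<dots> = Z * \<eta>"
      using is_pdaD(6)[OF ext(1) block_index_in[OF k a_in[OF k \<omega>]]] by simp
    finally show ?thesis .
  qed
  then have "computation_load storage \<omega> = real K * (real Z * real \<eta>) / real N"
    by (simp add: computation_load_def)
  also have "real N = real F * real \<eta>"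
    by (subst N_eq) (rule of_nat_mult)
  also have "real K * (real Z * real \<eta>) / (real F * real \<eta>) = real K * real Z / real F"
    using \<eta>_pos by simp
  also have "\<dots> = real r1 + (real K - real r1) * real r2 / real Q"
  proof -
    have r: "0 < r1" "r1 < K" "0 < r2" "r2 < Q" using r1 r2 by auto
    have le: "r1 \<le> K" "r2 \<le> Q" using r by auto
    have C: "0 < real ((K - 1) choose (r1 - 1))" "0 < real ((Q - 1) choose (r2 - 1))"
      using r by auto
    show ?thesis
      unfolding ext(2) of_nat_mult binomial_absorb_real[OF r(1) le(1)] binomial_absorb_real[OF r(3) le(2)]
      using r C by (simp add: field_simps)
  qed
  finally show ?thesis .
qed

text \<open>The unpadded total is
  \<open>K * ((K - 1) choose r1) * (Q choose (r2 + 1)) * \<delta>\<close>. Subtracting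
  \<open>extra\<close> makes the right-hand side the same for every padding, and clearing
  denominators leaves products to which the binomial identities apply.\<close>

lemma sum_seq_length:
  "real r1 * (real r2 + 1) * (real (\<Sum>k=1..K. seq_length k) - real extra) =
     (real K - real r1) * (real Q - real r2) * real N * real \<alpha>"
proof -
  have r: "0 < r1" "r1 < K" "0 < r2" "r2 < Q" using r1 r2 by auto
  let ?c = "((K - 1) choose r1) * ((Q choose Suc r2) * \<delta>)"
  have "card (coded_positions k) = ?c" if "k \<in> {1..K}" for k
    using card_subsets_containing[OF that, of "r1 + 1"]
    by (simp add: coded_positions_def card_cartesian_product)
  then have "(\<Sum>k=1..K. seq_length k) = (\<Sum>k=1..K. ?c + (if k = 1 then extra else 0))"
    by (intro sum.cong) (auto simp: seq_length_def)
  also have "\<dots> = K * ?c + extra"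
    using r by (simp add: sum.distrib)
  finally have s: "real (\<Sum>k=1..K. seq_length k) - real extra = real (K * ?c)" by simp
  \<comment> \<open>These identities trade the binomials of the integers for those of the rows,
    which together with \<open>\<eta>\<close> multiply to \<open>N\<close>.\<close>
  have K: "real K * real ((K - 1) choose r1) = (real K - real r1) * real (K choose r1)"
    using binomial_absorb_comp[of K r1] r by (simp flip: of_nat_mult of_nat_diff)
  have Q: "(real r2 + 1) * real (Q choose Suc r2) = (real Q - real r2) * real (Q choose r2)"
  proof -
    have "Suc r2 * (Q choose Suc r2) = (Q - r2) * (Q choose r2)"
      using binomial_absorption[of r2 Q] binomial_absorb_comp[of Q r2] by simp
    then have "real (Suc r2) * real (Q choose Suc r2) = real (Q - r2) * real (Q choose r2)"
      by (simp only: flip: of_nat_mult)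
    then show ?thesis using r by (simp add: of_nat_diff algebra_simps)
  qed
  have l: "real r1 * real \<delta> = real \<eta> * real \<alpha>"
    by (simp only: \<delta>_eq flip: of_nat_mult)
  have N: "real N = real (K choose r1) * real (Q choose r2) * real \<eta>"
    by (subst N_eq) (simp only: of_nat_mult)
  have "real r1 * (real r2 + 1) * real (K * ?c) =
      (real K * real ((K - 1) choose r1)) * ((real r2 + 1) * real (Q choose Suc r2)) * (real r1 * real \<delta>)"
    by (simp only: of_nat_mult mult_ac)
  also have "\<dots> = (real K - real r1) * (real Q - real r2) * real N * real \<alpha>"
    by (simp only: K Q l N mult_ac)
  finally show ?thesis unfolding s .
qed

end

section \<open>Padding to the claimed load and conclusion\<close>

theorem theorem3:
  fixes M :: "'a measure"
    and K Q N w \<alpha> b :: nat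
    and W :: "nat \<Rightarrow> 'a \<Rightarrow> bool list"
    and d :: "nat \<Rightarrow> 'a \<Rightarrow> nat"
    and g :: "nat \<Rightarrow> bool list \<Rightarrow> bool list"
    and h :: "nat \<Rightarrow> bool list list \<Rightarrow> bool list"
    and a :: "nat \<Rightarrow> 'a \<Rightarrow> nat"
  assumes model: "private_cdc M K Q N w \<alpha> b W d g h"
    and "K \<le> Q"
    and "private_cdc.local_randomness M K N W d a"
    and "private_cdc.uniform_on_functions M K Q a"
  shows
    "(\<forall>D. \<forall>t\<in>{1..D - 1}.
        is_pda D (D choose t) ((D - 1) choose (t - 1)) (D choose (t + 1)) (subset_pda D t) \<and>
        (\<forall>s\<in>{1..D choose (t + 1)}. occurrences D (D choose t) (subset_pda D t) s = t + 1)) \<and>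
     (\<forall>r1\<in>{1..K - 1}. \<forall>r2\<in>{1..Q - 1}.
        let F = (K choose r1) * (Q choose r2);
            P = extended_pda K Q r1 r2;
            r = real r1 + (real K - real r1) * real r2 / real Q;
            L = 1 / real r1 * (1 - real r1 / real K) * ((real Q - real r2) / (real r2 + 1))
        in
          (\<exists>Z. real Z = real ((K - 1) choose (r1 - 1)) * real ((Q - 1) choose (r2 - 1)) *
                         (real Q / real r2 + (real K - real r1) / real r1) \<and>
               is_pda (K * Q) F Z ((K choose (r1 + 1)) * (Q choose (r2 + 1))) P) \<and>
          (F dvd N \<and> r1 dvd (N div F) * \<alpha> \<and> L * (real Q * real N * real \<alpha>) \<in> \<nat> \<longrightarrow>
             (\<exists>m (y :: nat \<Rightarrow> 'a \<Rightarrow> nat list) X len.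
                private_cdc.cdc_scheme M K N W d g h a m y X len \<and>
                private_cdc.pda_corresponds M K Q N F P a m \<and>
                (\<forall>\<omega>\<in>space M. private_cdc.computation_load K N m \<omega> = r) \<and>
                private_cdc.communication_load K Q N \<alpha> len = L)))"
proof -
  interpret private_cdc M K Q N w \<alpha> b W d g h by (rule model)
  show ?thesis
    unfolding Let_def
  proof (intro conjI allI ballI impI)
    fix D t :: nat assume t: "t \<in> {1..D - 1}"
    show "is_pda D (D choose t) ((D - 1) choose (t - 1)) (D choose (t + 1)) (subset_pda D t)"
      using is_pda_subset_pda[OF t] by simp
    fix s :: nat assume "s \<in> {1..D choose (t + 1)}"
    then show "occurrences D (D choose t) (subset_pda D t) s = t + 1"
      using occurrences_subset_pda[of s D t] by simp
  next
    fix r1 r2 :: nat assume r: "r1 \<in> {1..K - 1}" "r2 \<in> {1..Q - 1}"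
    show "\<exists>Z. real Z = real ((K - 1) choose (r1 - 1)) * real ((Q - 1) choose (r2 - 1)) *
                         (real Q / real r2 + (real K - real r1) / real r1) \<and>
               is_pda (K * Q) ((K choose r1) * (Q choose r2)) Z
                 ((K choose (r1 + 1)) * (Q choose (r2 + 1))) (extended_pda K Q r1 r2)"
      using extended_pda_is_pda[OF r] by blast
  next
    fix r1 r2 :: nat assume r: "r1 \<in> {1..K - 1}" "r2 \<in> {1..Q - 1}"
    let ?F = "(K choose r1) * (Q choose r2)" and ?P = "extended_pda K Q r1 r2"
    let ?L = "1 / real r1 * (1 - real r1 / real K) * ((real Q - real r2) / (real r2 + 1))"
    assume *: "?F dvd N \<and> r1 dvd N div ?F * \<alpha> \<and> ?L * (real Q * real N * real \<alpha>) \<in> \<nat>"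
    \<comment> \<open>\<open>total\<close> is the number of bits that the claimed load
      prescribes.\<close>
    then obtain total where total: "?L * (real Q * real N * real \<alpha>) = real total"
      by (auto simp: Nats_def)
    have scheme: "coded_shuffle M K Q N w \<alpha> b W d g h r1 r2 a"
      using r * assms(3,4) by unfold_locales auto
    \<comment> \<open>\<open>base\<close> is the total length without padding; node 1 makes up the
      difference to \<open>total\<close>.\<close>
    define base where "base = (\<Sum>k=1..K. coded_shuffle.seq_length K Q N \<alpha> r1 r2 0 k)"
    define extra where "extra = total - base"
    interpret coded_shuffle M K Q N w \<alpha> b W d g h r1 r2 extra a
      by (rule scheme)
    interpret base: coded_shuffle M K Q N w \<alpha> b W d g h r1 r2 0 a
      by (rule scheme)
    have pos': "0 < real r1" "real r1 < real K" "0 < real r2" "real r2 < real Q"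
      using r by auto
    have "real r1 * (real r2 + 1) * real base =
        (real K - real r1) * (real Q - real r2) * real N * real \<alpha>"
      using base.sum_seq_length by (simp add: base_def)
    then have base: "real base = (real K - real r1) * (real Q - real r2) * real N * real \<alpha> /
        (real r1 * (real r2 + 1))"
      using pos' by (intro eq_divide_imp) (auto simp: mult.commute[of "real base"])
    have total_base: "real total = real base * (real Q / real K)"
      unfolding base total[symmetric] using pos' by (simp add: field_simps)
    \<comment> \<open>By \<open>K \<le> Q\<close> the unpadded scheme does not exceed
      \<open>total\<close>, so the natural subtraction in \<open>extra\<close> is exact.\<close>
    have "real base * 1 \<le> real base * (real Q / real K)"
      using pos' \<open>K \<le> Q\<close> by (intro mult_left_mono) auto
    then have "base \<le> total" using total_base by simp
    have "real r1 * (real r2 + 1) * (real (\<Sum>k=1..K. seq_length k) - real extra) =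
        real r1 * (real r2 + 1) * real base"
      using sum_seq_length base.sum_seq_length by (simp add: base_def)
    then have "real (\<Sum>k=1..K. seq_length k) = real total"
      using pos' \<open>base \<le> total\<close> by (simp add: extra_def of_nat_diff)
    then have "communication_load seq_length = ?L"
      using total[symmetric] pos by (simp add: communication_load_def)
    then show "\<exists>m (y :: nat \<Rightarrow> 'a \<Rightarrow> nat list) X len.
        cdc_scheme a m y X len \<and> pda_corresponds ?F ?P a m \<and>
        (\<forall>\<omega>\<in>space M. computation_load m \<omega> =
           real r1 + (real K - real r1) * real r2 / real Q) \<and>
        communication_load len = ?L"
      using cdc_scheme pda_corresponds computation_load by blast
  qed
qed

end
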